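(* A set of propositions $\operatorname{d}:\mathcal U\to\mathcal U$ is a dominance if and only if $\mathcal L_{\operatorname{d}}$ is a submonad of $\mathcal L$.
   Context: Type theory: Martin-Löf type theory with universe $\mathcal U$, function extensionality, proposition extensionality and propositional truncations. A set of propositions is $\operatorname{d}:\mathcal U\to\mathcal U$ with $\operatorname{isProp}(\operatorname{d}(X))$ and $\operatorname{d}(X)\to\operatorname{isProp}(X)$ for all $X$. It is a dominance if moreover $\operatorname{d}(1)$ and for all $P,Q:\mathcal U$, $\operatorname{d}(P)\to(P\to\operatorname{d}(Q))\to\operatorname{d}(P\times Q)$. $\mathcal L(Y):=\sum_{P:\mathcal U}\operatorname{isProp}(P)\times(P\to Y)$ is a monad (modulo raising the universe level) with unit $\eta(y)=(1,-,\lambda u.y)$ and Kleisli extension $f^\sharp(P,-,\varphi)=(\sum_{p:P}\operatorname{defined}(f(\varphi p)),-,(p,e)\mapsto\operatorname{value}(f(\varphi p))(e))$. $\mathcal L_{\operatorname{d}}(Y):=\sum_{P:\mathcal U}\operatorname{d}(P)\times(P\to Y)$, with embedding $i_Y:\mathcal L_{\operatorname{d}}(Y)\to\mathcal L(Y)$ forgetting to $(P,-,\varphi)$. $\mathcal L_{\operatorname{d}}$ is a submonad of $\mathcal L$ if each $\eta_Y$ factors through $i_Y$ and for every $f:X\to\mathcal L_{\operatorname{d}}(Y)$ there is $f':\mathcal L_{\operatorname{d}}(X)\to\mathcal L_{\operatorname{d}}(Y)$ with $i_Y\circ f'=(i_Y\circ f)^\sharp\circ i_X$. *)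

theory Defs
  imports Main
begin

text \<open>
  The statement is one of intensional Martin-Loef type theory.  Interpreting types by HOL types or
  sets and propositions by \<open>bool\<close> would validate excluded middle, under which the notion of
  dominance collapses.  The type theory is therefore represented by its syntax and derivation
  rules, and a theorem of type theory is a closed type with a derivable inhabitant.

  Universes \<open>U\<^sub>0 : U\<^sub>1 : \<dots>\<close> are Russell-style and non-cumulative (as in Agda); a type is a term that
  inhabits some universe.
\<close>

section \<open>Syntax\<close>

text \<open>Type formers other than \<open>\<Pi>\<close>, \<open>\<Sigma>\<close> and identity types are given by constants, whose numeric
  arguments are universe levels.\<close>

datatype con =
    EmptyT nat | EmptyInd nat nat
  | UnitT nat | Star nat | UnitInd nat nat
  | SumT nat nat | Inl nat nat | Inr nat nat | SumInd nat nat nat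
  | NatT | NatZero | NatSuc | NatInd nat
  | IdInd nat nat
  | Trunc nat | TruncIn nat | TruncProp nat | TruncRec nat nat
  | FunExt nat nat
  | PropExt nat

text \<open>De Bruijn indices; the second argument of \<open>Pi\<close>, \<open>Lam\<close> and \<open>Sig\<close> is in the scope of one
  additional variable.\<close>

datatype tm =
    Var nat
  | Univ nat
  | Con con
  | Pi tm tm | Lam tm tm | App tm tm
  | Sig tm tm | Pr tm tm | Fst tm | Snd tm
  | Eq tm tm tm | Refl tm

primrec lift :: "nat \<Rightarrow> tm \<Rightarrow> tm" where
  "lift k (Var x) = Var (if x < k then x else Suc x)"
| "lift k (Univ i) = Univ i"
| "lift k (Con c) = Con c"
| "lift k (Pi A B) = Pi (lift k A) (lift (Suc k) B)"
| "lift k (Lam A b) = Lam (lift k A) (lift (Suc k) b)"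
| "lift k (App f a) = App (lift k f) (lift k a)"
| "lift k (Sig A B) = Sig (lift k A) (lift (Suc k) B)"
| "lift k (Pr a b) = Pr (lift k a) (lift k b)"
| "lift k (Fst p) = Fst (lift k p)"
| "lift k (Snd p) = Snd (lift k p)"
| "lift k (Eq A a b) = Eq (lift k A) (lift k a) (lift k b)"
| "lift k (Refl a) = Refl (lift k a)"

text \<open>\<open>subst k s t\<close> replaces variable \<open>k\<close> of \<open>t\<close> by \<open>s\<close> and closes the gap.\<close>

primrec subst :: "nat \<Rightarrow> tm \<Rightarrow> tm \<Rightarrow> tm" where
  "subst k s (Var x) = (if x < k then Var x else if x = k then s else Var (x - 1))"
| "subst k s (Univ i) = Univ i"
| "subst k s (Con c) = Con c"
| "subst k s (Pi A B) = Pi (subst k s A) (subst (Suc k) (lift 0 s) B)"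
| "subst k s (Lam A b) = Lam (subst k s A) (subst (Suc k) (lift 0 s) b)"
| "subst k s (App f a) = App (subst k s f) (subst k s a)"
| "subst k s (Sig A B) = Sig (subst k s A) (subst (Suc k) (lift 0 s) B)"
| "subst k s (Pr a b) = Pr (subst k s a) (subst k s b)"
| "subst k s (Fst p) = Fst (subst k s p)"
| "subst k s (Snd p) = Snd (subst k s p)"
| "subst k s (Eq A a b) = Eq (subst k s A) (subst k s a) (subst k s b)"
| "subst k s (Refl a) = Refl (subst k s a)"


section \<open>Named surface syntax\<close>

text \<open>
  A \<open>sterm\<close> maps the number of enclosing binders to the de Bruijn term valid under that many
  binders.  A variable bound below \<open>n\<close> binders has index \<open>m - Suc n\<close> below \<open>m\<close> binders, so that HOL
  variables can stand for object variables and weakening is implicit.  A closed \<open>sterm\<close> \<open>t\<close> denotes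
  the term \<open>t 0\<close>.
\<close>

type_synonym sterm = "nat \<Rightarrow> tm"

definition bound :: "nat \<Rightarrow> sterm" where
  "bound n = (\<lambda>m. Var (m - Suc n))"

definition U :: "nat \<Rightarrow> sterm" where
  "U i = (\<lambda>n. Univ i)"

definition const :: "con \<Rightarrow> sterm" where
  "const c = (\<lambda>n. Con c)"

definition pi_ty :: "sterm \<Rightarrow> (sterm \<Rightarrow> sterm) \<Rightarrow> sterm" where
  "pi_ty A B = (\<lambda>n. Pi (A n) (B (bound n) (Suc n)))"

definition lam :: "sterm \<Rightarrow> (sterm \<Rightarrow> sterm) \<Rightarrow> sterm" where
  "lam A b = (\<lambda>n. Lam (A n) (b (bound n) (Suc n)))"

definition sig_ty :: "sterm \<Rightarrow> (sterm \<Rightarrow> sterm) \<Rightarrow> sterm" where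
  "sig_ty A B = (\<lambda>n. Sig (A n) (B (bound n) (Suc n)))"

definition app :: "sterm \<Rightarrow> sterm \<Rightarrow> sterm"  (infixl "\<cdot>" 90) where
  "f \<cdot> a = (\<lambda>n. App (f n) (a n))"

definition pair :: "sterm \<Rightarrow> sterm \<Rightarrow> sterm"  ("\<langle>_,/ _\<rangle>") where
  "\<langle>a, b\<rangle> = (\<lambda>n. Pr (a n) (b n))"

definition proj1 :: "sterm \<Rightarrow> sterm" where
  "proj1 p = (\<lambda>n. Fst (p n))"

definition proj2 :: "sterm \<Rightarrow> sterm" where
  "proj2 p = (\<lambda>n. Snd (p n))"

definition eq_ty :: "sterm \<Rightarrow> sterm \<Rightarrow> sterm \<Rightarrow> sterm" where
  "eq_ty A a b = (\<lambda>n. Eq (A n) (a n) (b n))"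

definition rfl :: "sterm \<Rightarrow> sterm" where
  "rfl a = (\<lambda>n. Refl (a n))"

syntax
  "_pi_ty" :: "pttrn \<Rightarrow> sterm \<Rightarrow> sterm \<Rightarrow> sterm"  ("(3\<Pi> _\<in>_./ _)" [0, 0, 10] 10)
  "_lam" :: "pttrn \<Rightarrow> sterm \<Rightarrow> sterm \<Rightarrow> sterm"  ("(3\<Lambda> _\<in>_./ _)" [0, 0, 10] 10)
  "_sig_ty" :: "pttrn \<Rightarrow> sterm \<Rightarrow> sterm \<Rightarrow> sterm"  ("(3\<Sigma> _\<in>_./ _)" [0, 0, 10] 10)
translations
  "\<Pi> x\<in>A. B" \<rightleftharpoons> "CONST pi_ty A (\<lambda>x. B)"
  "\<Lambda> x\<in>A. b" \<rightleftharpoons> "CONST lam A (\<lambda>x. b)"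
  "\<Sigma> x\<in>A. B" \<rightleftharpoons> "CONST sig_ty A (\<lambda>x. B)"

definition arrow :: "sterm \<Rightarrow> sterm \<Rightarrow> sterm"  (infixr "\<rightarrow>" 60) where
  "A \<rightarrow> B = (\<Pi> x\<in>A. B)"

definition prod_ty :: "sterm \<Rightarrow> sterm \<Rightarrow> sterm"  (infixr "\<otimes>" 70) where
  "A \<otimes> B = (\<Sigma> x\<in>A. B)"

definition iff_ty :: "sterm \<Rightarrow> sterm \<Rightarrow> sterm"  (infix "\<leftrightarrow>" 55) where
  "A \<leftrightarrow> B = (A \<rightarrow> B) \<otimes> (B \<rightarrow> A)"

definition is_prop :: "sterm \<Rightarrow> sterm" where
  "is_prop A = (\<Pi> x\<in>A. \<Pi> y\<in>A. eq_ty A x y)"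


section \<open>Derivation rules\<close>

primrec con_type :: "con \<Rightarrow> sterm" where
  "con_type (EmptyT i) = U i"
| "con_type (EmptyInd i j) =
    (\<Pi> C\<in>(const (EmptyT i) \<rightarrow> U j). \<Pi> z\<in>const (EmptyT i). C \<cdot> z)"
| "con_type (UnitT i) = U i"
| "con_type (Star i) = const (UnitT i)"
| "con_type (UnitInd i j) =
    (\<Pi> C\<in>(const (UnitT i) \<rightarrow> U j). C \<cdot> const (Star i) \<rightarrow> (\<Pi> z\<in>const (UnitT i). C \<cdot> z))"
| "con_type (SumT i j) = (U i \<rightarrow> U j \<rightarrow> U (max i j))"
| "con_type (Inl i j) = (\<Pi> A\<in>U i. \<Pi> B\<in>U j. A \<rightarrow> const (SumT i j) \<cdot> A \<cdot> B)"
| "con_type (Inr i j) = (\<Pi> A\<in>U i. \<Pi> B\<in>U j. B \<rightarrow> const (SumT i j) \<cdot> A \<cdot> B)"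
| "con_type (SumInd i j k) =
    (\<Pi> A\<in>U i. \<Pi> B\<in>U j. \<Pi> C\<in>(const (SumT i j) \<cdot> A \<cdot> B \<rightarrow> U k).
      (\<Pi> a\<in>A. C \<cdot> (const (Inl i j) \<cdot> A \<cdot> B \<cdot> a)) \<rightarrow>
      (\<Pi> b\<in>B. C \<cdot> (const (Inr i j) \<cdot> A \<cdot> B \<cdot> b)) \<rightarrow>
      (\<Pi> z\<in>const (SumT i j) \<cdot> A \<cdot> B. C \<cdot> z))"
| "con_type NatT = U 0"
| "con_type NatZero = const NatT"
| "con_type NatSuc = (const NatT \<rightarrow> const NatT)"
| "con_type (NatInd j) =
    (\<Pi> C\<in>(const NatT \<rightarrow> U j).
      C \<cdot> const NatZero \<rightarrow>
      (\<Pi> x\<in>const NatT. C \<cdot> x \<rightarrow> C \<cdot> (const NatSuc \<cdot> x)) \<rightarrow>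
      (\<Pi> x\<in>const NatT. C \<cdot> x))"
| "con_type (IdInd i j) =
    (\<Pi> A\<in>U i. \<Pi> x\<in>A. \<Pi> C\<in>(\<Pi> y\<in>A. eq_ty A x y \<rightarrow> U j).
      C \<cdot> x \<cdot> rfl x \<rightarrow> (\<Pi> y\<in>A. \<Pi> p\<in>eq_ty A x y. C \<cdot> y \<cdot> p))"
| "con_type (Trunc i) = (U i \<rightarrow> U i)"
| "con_type (TruncIn i) = (\<Pi> A\<in>U i. A \<rightarrow> const (Trunc i) \<cdot> A)"
| "con_type (TruncProp i) = (\<Pi> A\<in>U i. is_prop (const (Trunc i) \<cdot> A))"
| "con_type (TruncRec i j) =
    (\<Pi> A\<in>U i. \<Pi> B\<in>U j. is_prop B \<rightarrow> (A \<rightarrow> B) \<rightarrow> const (Trunc i) \<cdot> A \<rightarrow> B)"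
| "con_type (FunExt i j) =
    (\<Pi> A\<in>U i. \<Pi> B\<in>(A \<rightarrow> U j). \<Pi> f\<in>(\<Pi> x\<in>A. B \<cdot> x). \<Pi> g\<in>(\<Pi> x\<in>A. B \<cdot> x).
      (\<Pi> x\<in>A. eq_ty (B \<cdot> x) (f \<cdot> x) (g \<cdot> x)) \<rightarrow> eq_ty (\<Pi> x\<in>A. B \<cdot> x) f g)"
| "con_type (PropExt i) =
    (\<Pi> P\<in>U i. \<Pi> Q\<in>U i. is_prop P \<rightarrow> is_prop Q \<rightarrow> (P \<rightarrow> Q) \<rightarrow> (Q \<rightarrow> P) \<rightarrow> eq_ty (U i) P Q)"

text \<open>Computation rules of the eliminators that are given as constants.  The axioms and the
  eliminator of the truncation have none.\<close>

abbreviation (input) apps :: "tm \<Rightarrow> tm list \<Rightarrow> tm" where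
  "apps f as \<equiv> foldl App f as"

inductive computes :: "tm \<Rightarrow> tm \<Rightarrow> bool" where
  "computes (apps (Con (UnitInd i j)) [C, c, Con (Star i)]) c"
| "computes (apps (Con (SumInd i j k)) [A, B, C, f, g, apps (Con (Inl i j)) [A, B, a]]) (App f a)"
| "computes (apps (Con (SumInd i j k)) [A, B, C, f, g, apps (Con (Inr i j)) [A, B, b]]) (App g b)"
| "computes (apps (Con (NatInd j)) [C, c, s, Con NatZero]) c"
| "computes (apps (Con (NatInd j)) [C, c, s, App (Con NatSuc) n])
    (apps s [n, apps (Con (NatInd j)) [C, c, s, n]])"
| "computes (apps (Con (IdInd i j)) [A, a, C, c, a, Refl a]) c"

text \<open>A context lists the types of its variables, the most recent one first; each type lives in the
  context formed by the rest of the list.\<close>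

inductive
  ctx :: "tm list \<Rightarrow> bool" and
  typing :: "tm list \<Rightarrow> tm \<Rightarrow> tm \<Rightarrow> bool"  ("_ \<turnstile> _ \<Ztypecolon> _" [50, 50, 50] 50) and
  eqtyping :: "tm list \<Rightarrow> tm \<Rightarrow> tm \<Rightarrow> tm \<Rightarrow> bool"  ("_ \<turnstile> _ \<simeq> _ \<Ztypecolon> _" [50, 50, 50, 50] 50)
where
  ctx_nil: "ctx []"
| ctx_cons: "ctx \<Gamma> \<Longrightarrow> \<Gamma> \<turnstile> A \<Ztypecolon> Univ i \<Longrightarrow> ctx (A # \<Gamma>)"

| ty_var: "ctx \<Gamma> \<Longrightarrow> x < length \<Gamma> \<Longrightarrow> \<Gamma> \<turnstile> Var x \<Ztypecolon> (lift 0 ^^ Suc x) (\<Gamma> ! x)"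
| ty_univ: "ctx \<Gamma> \<Longrightarrow> \<Gamma> \<turnstile> Univ i \<Ztypecolon> Univ (Suc i)"
| ty_con: "ctx \<Gamma> \<Longrightarrow> \<Gamma> \<turnstile> Con c \<Ztypecolon> con_type c 0"
| ty_pi: "\<Gamma> \<turnstile> A \<Ztypecolon> Univ i \<Longrightarrow> A # \<Gamma> \<turnstile> B \<Ztypecolon> Univ j \<Longrightarrow> \<Gamma> \<turnstile> Pi A B \<Ztypecolon> Univ (max i j)"
| ty_lam: "A # \<Gamma> \<turnstile> b \<Ztypecolon> B \<Longrightarrow> \<Gamma> \<turnstile> Lam A b \<Ztypecolon> Pi A B"
| ty_app: "\<Gamma> \<turnstile> f \<Ztypecolon> Pi A B \<Longrightarrow> \<Gamma> \<turnstile> a \<Ztypecolon> A \<Longrightarrow> \<Gamma> \<turnstile> App f a \<Ztypecolon> subst 0 a B"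
| ty_sig: "\<Gamma> \<turnstile> A \<Ztypecolon> Univ i \<Longrightarrow> A # \<Gamma> \<turnstile> B \<Ztypecolon> Univ j \<Longrightarrow> \<Gamma> \<turnstile> Sig A B \<Ztypecolon> Univ (max i j)"
| ty_pair: "A # \<Gamma> \<turnstile> B \<Ztypecolon> Univ j \<Longrightarrow> \<Gamma> \<turnstile> a \<Ztypecolon> A \<Longrightarrow> \<Gamma> \<turnstile> b \<Ztypecolon> subst 0 a B \<Longrightarrow>
    \<Gamma> \<turnstile> Pr a b \<Ztypecolon> Sig A B"
| ty_fst: "\<Gamma> \<turnstile> p \<Ztypecolon> Sig A B \<Longrightarrow> \<Gamma> \<turnstile> Fst p \<Ztypecolon> A"
| ty_snd: "\<Gamma> \<turnstile> p \<Ztypecolon> Sig A B \<Longrightarrow> \<Gamma> \<turnstile> Snd p \<Ztypecolon> subst 0 (Fst p) B"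
| ty_eq: "\<Gamma> \<turnstile> A \<Ztypecolon> Univ i \<Longrightarrow> \<Gamma> \<turnstile> a \<Ztypecolon> A \<Longrightarrow> \<Gamma> \<turnstile> b \<Ztypecolon> A \<Longrightarrow> \<Gamma> \<turnstile> Eq A a b \<Ztypecolon> Univ i"
| ty_refl: "\<Gamma> \<turnstile> a \<Ztypecolon> A \<Longrightarrow> \<Gamma> \<turnstile> Refl a \<Ztypecolon> Eq A a a"
| ty_conv: "\<Gamma> \<turnstile> a \<Ztypecolon> A \<Longrightarrow> \<Gamma> \<turnstile> A \<simeq> B \<Ztypecolon> Univ i \<Longrightarrow> \<Gamma> \<turnstile> a \<Ztypecolon> B"

| eq_refl: "\<Gamma> \<turnstile> a \<Ztypecolon> A \<Longrightarrow> \<Gamma> \<turnstile> a \<simeq> a \<Ztypecolon> A"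
| eq_sym: "\<Gamma> \<turnstile> a \<simeq> b \<Ztypecolon> A \<Longrightarrow> \<Gamma> \<turnstile> b \<simeq> a \<Ztypecolon> A"
| eq_trans: "\<Gamma> \<turnstile> a \<simeq> b \<Ztypecolon> A \<Longrightarrow> \<Gamma> \<turnstile> b \<simeq> c \<Ztypecolon> A \<Longrightarrow> \<Gamma> \<turnstile> a \<simeq> c \<Ztypecolon> A"
| eq_conv: "\<Gamma> \<turnstile> a \<simeq> b \<Ztypecolon> A \<Longrightarrow> \<Gamma> \<turnstile> A \<simeq> B \<Ztypecolon> Univ i \<Longrightarrow> \<Gamma> \<turnstile> a \<simeq> b \<Ztypecolon> B"

| eq_pi: "\<Gamma> \<turnstile> A \<simeq> A' \<Ztypecolon> Univ i \<Longrightarrow> A # \<Gamma> \<turnstile> B \<simeq> B' \<Ztypecolon> Univ j \<Longrightarrow>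
    \<Gamma> \<turnstile> Pi A B \<simeq> Pi A' B' \<Ztypecolon> Univ (max i j)"
| eq_lam: "\<Gamma> \<turnstile> A \<simeq> A' \<Ztypecolon> Univ i \<Longrightarrow> A # \<Gamma> \<turnstile> b \<simeq> b' \<Ztypecolon> B \<Longrightarrow> \<Gamma> \<turnstile> Lam A b \<simeq> Lam A' b' \<Ztypecolon> Pi A B"
| eq_app: "\<Gamma> \<turnstile> f \<simeq> f' \<Ztypecolon> Pi A B \<Longrightarrow> \<Gamma> \<turnstile> a \<simeq> a' \<Ztypecolon> A \<Longrightarrow> \<Gamma> \<turnstile> App f a \<simeq> App f' a' \<Ztypecolon> subst 0 a B"
| eq_sig: "\<Gamma> \<turnstile> A \<simeq> A' \<Ztypecolon> Univ i \<Longrightarrow> A # \<Gamma> \<turnstile> B \<simeq> B' \<Ztypecolon> Univ j \<Longrightarrow>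
    \<Gamma> \<turnstile> Sig A B \<simeq> Sig A' B' \<Ztypecolon> Univ (max i j)"
| eq_pair: "A # \<Gamma> \<turnstile> B \<Ztypecolon> Univ j \<Longrightarrow> \<Gamma> \<turnstile> a \<simeq> a' \<Ztypecolon> A \<Longrightarrow> \<Gamma> \<turnstile> b \<simeq> b' \<Ztypecolon> subst 0 a B \<Longrightarrow>
    \<Gamma> \<turnstile> Pr a b \<simeq> Pr a' b' \<Ztypecolon> Sig A B"
| eq_fst: "\<Gamma> \<turnstile> p \<simeq> p' \<Ztypecolon> Sig A B \<Longrightarrow> \<Gamma> \<turnstile> Fst p \<simeq> Fst p' \<Ztypecolon> A"
| eq_snd: "\<Gamma> \<turnstile> p \<simeq> p' \<Ztypecolon> Sig A B \<Longrightarrow> \<Gamma> \<turnstile> Snd p \<simeq> Snd p' \<Ztypecolon> subst 0 (Fst p) B"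
| eq_eq: "\<Gamma> \<turnstile> A \<simeq> A' \<Ztypecolon> Univ i \<Longrightarrow> \<Gamma> \<turnstile> a \<simeq> a' \<Ztypecolon> A \<Longrightarrow> \<Gamma> \<turnstile> b \<simeq> b' \<Ztypecolon> A \<Longrightarrow>
    \<Gamma> \<turnstile> Eq A a b \<simeq> Eq A' a' b' \<Ztypecolon> Univ i"
| eq_rfl: "\<Gamma> \<turnstile> a \<simeq> a' \<Ztypecolon> A \<Longrightarrow> \<Gamma> \<turnstile> Refl a \<simeq> Refl a' \<Ztypecolon> Eq A a a"

| pi_beta: "A # \<Gamma> \<turnstile> b \<Ztypecolon> B \<Longrightarrow> \<Gamma> \<turnstile> a \<Ztypecolon> A \<Longrightarrow> \<Gamma> \<turnstile> App (Lam A b) a \<simeq> subst 0 a b \<Ztypecolon> subst 0 a B"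
| pi_eta: "\<Gamma> \<turnstile> f \<Ztypecolon> Pi A B \<Longrightarrow> \<Gamma> \<turnstile> Lam A (App (lift 0 f) (Var 0)) \<simeq> f \<Ztypecolon> Pi A B"
| sig_beta1: "A # \<Gamma> \<turnstile> B \<Ztypecolon> Univ j \<Longrightarrow> \<Gamma> \<turnstile> a \<Ztypecolon> A \<Longrightarrow> \<Gamma> \<turnstile> b \<Ztypecolon> subst 0 a B \<Longrightarrow>
    \<Gamma> \<turnstile> Fst (Pr a b) \<simeq> a \<Ztypecolon> A"
| sig_beta2: "A # \<Gamma> \<turnstile> B \<Ztypecolon> Univ j \<Longrightarrow> \<Gamma> \<turnstile> a \<Ztypecolon> A \<Longrightarrow> \<Gamma> \<turnstile> b \<Ztypecolon> subst 0 a B \<Longrightarrow>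
    \<Gamma> \<turnstile> Snd (Pr a b) \<simeq> b \<Ztypecolon> subst 0 a B"
| sig_eta: "\<Gamma> \<turnstile> p \<Ztypecolon> Sig A B \<Longrightarrow> \<Gamma> \<turnstile> Pr (Fst p) (Snd p) \<simeq> p \<Ztypecolon> Sig A B"
| con_comp: "computes t u \<Longrightarrow> \<Gamma> \<turnstile> t \<Ztypecolon> A \<Longrightarrow> \<Gamma> \<turnstile> u \<Ztypecolon> A \<Longrightarrow> \<Gamma> \<turnstile> t \<simeq> u \<Ztypecolon> A"

definition inhabited :: "sterm \<Rightarrow> bool" where
  "inhabited A \<longleftrightarrow> (\<exists>t. [] \<turnstile> t \<Ztypecolon> A 0)"


section \<open>Dominances and the lifting monad\<close>

text \<open>The universe in which the propositions live is \<open>U n\<close>; accordingly \<open>Lift n Y\<close> and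
  \<open>Lift_d n d Y\<close> live in \<open>U (Suc n)\<close> for \<open>Y\<close> in \<open>U n\<close>.\<close>

definition is_set_of_props :: "nat \<Rightarrow> sterm \<Rightarrow> sterm" where
  "is_set_of_props n d = (\<Pi> X\<in>U n. is_prop (d \<cdot> X)) \<otimes> (\<Pi> X\<in>U n. d \<cdot> X \<rightarrow> is_prop X)"

definition is_dominance :: "nat \<Rightarrow> sterm \<Rightarrow> sterm" where
  "is_dominance n d =
    is_set_of_props n d \<otimes>
    d \<cdot> const (UnitT n) \<otimes>
    (\<Pi> P\<in>U n. \<Pi> Q\<in>U n. d \<cdot> P \<rightarrow> (P \<rightarrow> d \<cdot> Q) \<rightarrow> d \<cdot> (P \<otimes> Q))"

definition Lift :: "nat \<Rightarrow> sterm \<Rightarrow> sterm" where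
  "Lift n Y = (\<Sigma> P\<in>U n. is_prop P \<otimes> (P \<rightarrow> Y))"

definition Lift_d :: "nat \<Rightarrow> sterm \<Rightarrow> sterm \<Rightarrow> sterm" where
  "Lift_d n d Y = (\<Sigma> P\<in>U n. d \<cdot> P \<otimes> (P \<rightarrow> Y))"

text \<open>These apply to elements of both \<open>Lift\<close> and \<open>Lift_d\<close>.\<close>

definition defined :: "sterm \<Rightarrow> sterm" where
  "defined u = proj1 u"

definition witness :: "sterm \<Rightarrow> sterm" where
  "witness u = proj1 (proj2 u)"

definition val :: "sterm \<Rightarrow> sterm" where
  "val u = proj2 (proj2 u)"

text \<open>The proofs of propositionhood that accompany the unit and the Kleisli extension: the unit
  type is a proposition, and so is a sum of propositions indexed by a proposition.\<close>

definition unit_prop :: "nat \<Rightarrow> sterm" where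
  "unit_prop n =
    (let one = const (UnitT n); star = const (Star n) in
      const (UnitInd n n) \<cdot> (\<Lambda> x\<in>one. \<Pi> y\<in>one. eq_ty one x y)
        \<cdot> (const (UnitInd n n) \<cdot> (\<Lambda> y\<in>one. eq_ty one star y) \<cdot> rfl star))"

definition sigma_prop :: "nat \<Rightarrow> sterm \<Rightarrow> (sterm \<Rightarrow> sterm) \<Rightarrow> sterm \<Rightarrow> (sterm \<Rightarrow> sterm) \<Rightarrow> sterm" where
  "sigma_prop n P Q hP hQ =
    (let S = (\<Sigma> p\<in>P. Q p) in
      \<Lambda> v\<in>S. \<Lambda> w\<in>S.
        const (IdInd n n) \<cdot> P \<cdot> proj1 v
          \<cdot> (\<Lambda> y\<in>P. \<Lambda> r\<in>eq_ty P (proj1 v) y. \<Pi> e\<in>Q y. eq_ty S v \<langle>y, e\<rangle>)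
          \<cdot> (\<Lambda> e\<in>Q (proj1 v).
              const (IdInd n n) \<cdot> Q (proj1 v) \<cdot> proj2 v
                \<cdot> (\<Lambda> e'\<in>Q (proj1 v). \<Lambda> r\<in>eq_ty (Q (proj1 v)) (proj2 v) e'. eq_ty S v \<langle>proj1 v, e'\<rangle>)
                \<cdot> rfl v \<cdot> e \<cdot> (hQ (proj1 v) \<cdot> proj2 v \<cdot> e))
          \<cdot> proj1 w \<cdot> (hP \<cdot> proj1 v \<cdot> proj1 w) \<cdot> proj2 w)"

definition \<eta> :: "nat \<Rightarrow> sterm \<Rightarrow> sterm" where
  "\<eta> n Y = (\<Lambda> y\<in>Y. \<langle>const (UnitT n), \<langle>unit_prop n, \<Lambda> u\<in>const (UnitT n). y\<rangle>\<rangle>)"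

definition kleisli :: "nat \<Rightarrow> sterm \<Rightarrow> sterm \<Rightarrow> sterm \<Rightarrow> sterm" where
  "kleisli n X Y f =
    (\<Lambda> u\<in>Lift n X.
      \<langle>\<Sigma> p\<in>defined u. defined (f \<cdot> (val u \<cdot> p)),
       \<langle>sigma_prop n (defined u) (\<lambda>p. defined (f \<cdot> (val u \<cdot> p)))
          (witness u) (\<lambda>p. witness (f \<cdot> (val u \<cdot> p))),
        \<Lambda> w\<in>(\<Sigma> p\<in>defined u. defined (f \<cdot> (val u \<cdot> p))).
          val (f \<cdot> (val u \<cdot> proj1 w)) \<cdot> proj2 w\<rangle>\<rangle>)"

text \<open>The embedding of \<open>Lift_d\<close> into \<open>Lift\<close>, given a proof \<open>s\<close> that \<open>d\<close> is a set of
  propositions.\<close>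

definition incl :: "nat \<Rightarrow> sterm \<Rightarrow> sterm \<Rightarrow> sterm \<Rightarrow> sterm" where
  "incl n d s Y =
    (\<Lambda> u\<in>Lift_d n d Y. \<langle>defined u, \<langle>proj2 s \<cdot> defined u \<cdot> witness u, val u\<rangle>\<rangle>)"

text \<open>\<open>compose A g f\<close> is the composite of \<open>f : A \<rightarrow> B\<close> and \<open>g : B \<rightarrow> C\<close>.\<close>

definition compose :: "sterm \<Rightarrow> sterm \<Rightarrow> sterm \<Rightarrow> sterm" where
  "compose A g f = (\<Lambda> x\<in>A. g \<cdot> (f \<cdot> x))"

text \<open>Factorisations through \<open>incl\<close> are unique because \<open>d\<close> is proposition-valued, so stating their
  existence by \<open>\<Sigma>\<close> is equivalent to stating it by a truncated \<open>\<Sigma>\<close>.\<close>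

definition is_submonad :: "nat \<Rightarrow> sterm \<Rightarrow> sterm \<Rightarrow> sterm" where
  "is_submonad n d s =
    (\<Pi> Y\<in>U n. \<Sigma> e\<in>(Y \<rightarrow> Lift_d n d Y).
      eq_ty (Y \<rightarrow> Lift n Y) (compose Y (incl n d s Y) e) (\<eta> n Y)) \<otimes>
    (\<Pi> X\<in>U n. \<Pi> Y\<in>U n. \<Pi> f\<in>(X \<rightarrow> Lift_d n d Y). \<Sigma> f'\<in>(Lift_d n d X \<rightarrow> Lift_d n d Y).
      eq_ty (Lift_d n d X \<rightarrow> Lift n Y)
        (compose (Lift_d n d X) (incl n d s Y) f')
        (compose (Lift_d n d X) (kleisli n X Y (compose X (incl n d s Y) f)) (incl n d s X)))"

end

theory Submission
  imports Defs
begin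

text \<open>
  A factorisation of \<open>F : A \<rightarrow> \<L> Y\<close> through \<open>\<L>\<^sub>d Y\<close> exists if and only if \<open>d (defined (F a))\<close> holds for all
  \<open>a : A\<close>: the data of \<open>\<L> Y\<close> and \<open>\<L>\<^sub>d Y\<close> differ only in the proof component, and being a proposition is
  a proposition.  Applied to the unit at \<open>1\<close> this is \<open>d 1\<close>.  Applied to Kleisli extensions it says that
  \<open>d\<close> is closed under \<open>\<Sigma> p\<in>P. Q p\<close> for \<open>Q : P \<rightarrow> U\<close>.  A dominance only provides this for constant
  \<open>Q\<close>, but for \<open>S = \<Sigma> p\<in>P. Q p\<close> proposition extensionality identifies \<open>S\<close> with \<open>Q p\<close> as soon as \<open>p : P\<close>
  is given, so \<open>d (P \<times> S)\<close> holds, and \<open>P \<times> S = S\<close> again by proposition extensionality.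

  Weakening and substitution are the only metatheory needed.  Inhabitants that no type mentions are
  hidden behind an existential quantifier (\<open>inhab\<close>).
\<close>

section \<open>Weakening and substitution\<close>

text \<open>The goal is the existence of a derivation, so each construction must be typed under the
  binders where it is used. For this reason the lemmas hold in an arbitrary context, and the locales
  come with a rule that moves them under one more variable. The constructions of the statement are
  mirrored by functions on de Bruijn terms that commute with \<open>lift\<close> and
  \<open>subst\<close>; they stay folded until the last step, which compares them syntactically with
  the named version.

  The two equalities share the work. Domain and value of an embedded element agree judgementally
  with those of the original, so conversion takes care of them. Paths are needed for the proof
  component, which may change when a map is factored and composed back, and for proposition
  extensionality in the closure under dependent sums. In the converse direction the Kleisli
  extension is evaluated at an element with domain P, along a map all of whose values have domain Q,
  so that its domain is judgementally P \<times> Q.\<close>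

lemma lift_lift: "i \<le> k \<Longrightarrow> lift (Suc k) (lift i t) = lift i (lift k t)"
  by (induction t arbitrary: i k) auto

lemma subst_lift: "subst k s (lift k t) = t"
  by (induction t arbitrary: k s) auto

lemma subst_Suc_lift: "i \<le> k \<Longrightarrow> subst (Suc k) (lift i s) (lift i t) = lift i (subst k s t)"
  by (induction t arbitrary: i k s) (auto simp: lift_lift[OF le0, symmetric])

lemma lift_subst: "i \<le> k \<Longrightarrow> lift k (subst i s t) = subst i (lift k s) (lift (Suc k) t)"
  by (induction t arbitrary: i k s) (auto simp: lift_lift[OF le0, symmetric])

lemma subst_subst:
  "i \<le> k \<Longrightarrow> subst k s (subst i a t) = subst i (subst k s a) (subst (Suc k) (lift i s) t)"
  by (induction t arbitrary: i k s a)
    (auto simp: subst_lift lift_lift[OF le0, symmetric] subst_Suc_lift[OF le0, symmetric])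

text \<open>Contracting a weakened abstraction against one of its new variables produces such terms.
  Here the body returns unchanged; in the next two lemmas one or two further new variables lie in
  between and remain as lifts.\<close>

lemma subst_Var_lift_Suc: "subst k (Var k) (lift (Suc k) t) = t"
  by (induction t arbitrary: k) auto

lemma subst_Var_Suc_lift_Suc: "subst k (Var (Suc k)) (lift (Suc k) (lift (Suc k) t)) = lift k t"
  by (induction t arbitrary: k) auto

lemma subst_Var_Suc_Suc_lift_Suc:
  "subst k (Var (Suc (Suc k))) (lift (Suc k) (lift (Suc k) (lift (Suc k) t))) = lift k (lift k t)"
  by (induction t arbitrary: k) auto

lemmas lift_simps [simp] =
  lift_lift[OF le0] subst_lift subst_Suc_lift[OF le0]
  subst_Var_lift_Suc subst_Var_Suc_lift_Suc subst_Var_Suc_Suc_lift_Suc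

lemmas sterm_defs = bound_def U_def const_def pi_ty_def lam_def sig_ty_def app_def pair_def
  proj1_def proj2_def eq_ty_def rfl_def arrow_def prod_ty_def iff_ty_def is_prop_def

text \<open>The types of constants are closed terms. Together with its analogue for
  \<open>subst\<close> this settles the rule \<open>ty_con\<close> in both metatheorems.\<close>

lemma lift_con_type [simp]: "lift k (con_type c 0) = con_type c 0"
  by (cases c) (auto simp: sterm_defs)

lemma subst_con_type [simp]: "subst k s (con_type c 0) = con_type c 0"
  by (cases c) (auto simp: sterm_defs)

lemma computes_lift: "computes t u \<Longrightarrow> computes (lift k t) (lift k u)"
  \<comment> \<open>\<open>apps\<close> is a fold over a literal list; \<open>[simplified]\<close>
    turns the rules into nested applications, the form that the goals take once \<open>lift\<close>
    is pushed inwards.\<close>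
  by (induction rule: computes.induct) (auto intro: computes.intros[simplified])

lemma computes_subst: "computes t u \<Longrightarrow> computes (subst k s t) (subst k s u)"
  by (induction rule: computes.induct) (auto intro: computes.intros[simplified])

text \<open>\<open>insert_var A k \<Gamma> \<Gamma>'\<close>: the context \<open>\<Gamma>'\<close> arises from \<open>\<Gamma>\<close> by inserting a variable of type \<open>A\<close>
  below the \<open>k\<close> most recent variables.\<close>

inductive insert_var :: "tm \<Rightarrow> nat \<Rightarrow> tm list \<Rightarrow> tm list \<Rightarrow> bool" for A where
  insert_0: "ctx (A # \<Gamma>) \<Longrightarrow> insert_var A 0 \<Gamma> (A # \<Gamma>)"
| insert_Suc: "insert_var A k \<Gamma> \<Gamma>' \<Longrightarrow> insert_var A (Suc k) (B # \<Gamma>) (lift k B # \<Gamma>')"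

inductive_cases insert_var_Nil: "insert_var A k [] \<Gamma>'"
inductive_cases insert_var_Cons: "insert_var A k (B # \<Gamma>) \<Gamma>'"

text \<open>The variable case of weakening. A variable more recent than the insertion keeps its
  index and finds the lift in its context entry; an older one keeps its entry and gets the lift from
  its larger index.\<close>

lemma insert_var_nth:
  assumes "insert_var A k \<Gamma> \<Gamma>'" "x < length \<Gamma>"
  shows "(if x < k then x else Suc x) < length \<Gamma>' \<and>
    (lift 0 ^^ Suc (if x < k then x else Suc x)) (\<Gamma>' ! (if x < k then x else Suc x)) =
    lift k ((lift 0 ^^ Suc x) (\<Gamma> ! x))"
  using assms
proof (induction arbitrary: x rule: insert_var.induct)
  case (insert_Suc k \<Gamma> \<Gamma>' B)
  show ?case
  proof (cases x)
    case (Suc y)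
    then show ?thesis using insert_Suc.IH[of y] insert_Suc.prems by (auto split: if_splits)
  qed auto
qed auto

text \<open>Rules whose conclusion restricts the shape of the goal, safe for backward search.
  Conversion, symmetry and transitivity apply to goals of any shape and get their own cases
  below.\<close>

lemmas syntax_rules = ctx_nil ty_univ ty_con ty_pi ty_lam ty_app ty_sig ty_pair ty_fst ty_snd
    ty_eq ty_refl eq_refl eq_pi eq_lam eq_app eq_sig eq_pair eq_fst eq_snd eq_eq eq_rfl pi_beta
        pi_eta sig_beta1 sig_beta2 sig_eta

text \<open>The depth \<open>k\<close> has to vary because a rule for a binder extends the context
  on the recent side of the inserted variable.\<close>

lemma weakening_general:
  "ctx \<Gamma> \<Longrightarrow> insert_var A k \<Gamma> \<Gamma>' \<Longrightarrow> ctx \<Gamma>'"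
  "\<Gamma> \<turnstile> t \<Ztypecolon> T \<Longrightarrow> insert_var A k \<Gamma> \<Gamma>' \<Longrightarrow> \<Gamma>' \<turnstile> lift k t \<Ztypecolon> lift k T"
  "\<Gamma> \<turnstile> t \<simeq> u \<Ztypecolon> T \<Longrightarrow> insert_var A k \<Gamma> \<Gamma>' \<Longrightarrow> \<Gamma>' \<turnstile> lift k t \<simeq> lift k u \<Ztypecolon> lift k T"
proof (induction arbitrary: k \<Gamma>' and k \<Gamma>' and k \<Gamma>' rule: ctx_typing_eqtyping.inducts)
  case (ctx_cons \<Gamma> B i)
  from ctx_cons.prems show ?case
    by (rule insert_var_Cons)
      (use ctx_cons.hyps in \<open>auto intro: ctx_typing_eqtyping.ctx_cons ctx_cons.IH(1)
        ctx_cons.IH(2)[simplified]\<close>)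
next
  case (ty_var \<Gamma> x)
  then show ?case
    using insert_var_nth[OF ty_var.prems ty_var.hyps(2)]
      ctx_typing_eqtyping.ty_var[of \<Gamma>' "if x < k then x else Suc x"]
    by (simp only: lift.simps)
next
  case ty_conv
  then show ?case by (simp, blast intro: ctx_typing_eqtyping.ty_conv)
next
  case eq_conv
  then show ?case by (simp, blast intro: ctx_typing_eqtyping.eq_conv)
next
  case eq_sym
  then show ?case by (blast intro: ctx_typing_eqtyping.eq_sym)
next
  case eq_trans
  then show ?case by (blast intro: ctx_typing_eqtyping.eq_trans)
next
  case (con_comp t u \<Gamma> B)
  then show ?case by (blast intro: ctx_typing_eqtyping.con_comp computes_lift)
next
  case ctx_nil
  then show ?case by (blast elim: insert_var_Nil intro: ctx_typing_eqtyping.ctx_nil)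
qed (simp_all add: lift_subst[OF le0], (blast intro: syntax_rules insert_Suc)+)

lemma weakening:
  assumes "ctx (A # \<Gamma>)"
  shows "\<Gamma> \<turnstile> t \<Ztypecolon> T \<Longrightarrow> A # \<Gamma> \<turnstile> lift 0 t \<Ztypecolon> lift 0 T"
    and "\<Gamma> \<turnstile> t \<simeq> u \<Ztypecolon> T \<Longrightarrow> A # \<Gamma> \<turnstile> lift 0 t \<simeq> lift 0 u \<Ztypecolon> lift 0 T"
  using weakening_general(2,3) insert_0[OF assms] by blast+

lemma ctx_tail: "ctx (A # \<Gamma>) \<Longrightarrow> ctx \<Gamma>"
  by (erule ctx.cases) auto

text \<open>The first clause is a placeholder for the mutual induction. Well-formedness of the
  context is read off from derivations in this way; well-formedness of types is passed along as
  hypotheses instead.\<close>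

lemma typing_ctx:
  "ctx \<Gamma> \<Longrightarrow> True"
  "\<Gamma> \<turnstile> t \<Ztypecolon> T \<Longrightarrow> ctx \<Gamma>"
  "\<Gamma> \<turnstile> t \<simeq> u \<Ztypecolon> T \<Longrightarrow> ctx \<Gamma>"
  by (induction rule: ctx_typing_eqtyping.inducts) (auto dest: ctx_tail)

text \<open>The counterpart of \<open>insert_var\<close> for a substitution at depth
  \<open>k\<close>. The term \<open>s\<close> is lifted once for each variable crossed, just as
  \<open>subst\<close> does under a binder.\<close>

inductive subst_var :: "tm \<Rightarrow> nat \<Rightarrow> tm list \<Rightarrow> tm list \<Rightarrow> bool" where
  subst_0: "\<Gamma> \<turnstile> s \<Ztypecolon> A \<Longrightarrow> subst_var s 0 (A # \<Gamma>) \<Gamma>"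
| subst_Suc: "subst_var s k \<Gamma> \<Gamma>' \<Longrightarrow> subst_var (lift 0 s) (Suc k) (B # \<Gamma>) (subst k s B # \<Gamma>')"

inductive_cases subst_var_Nil: "subst_var s k [] \<Gamma>'"
inductive_cases subst_var_Cons: "subst_var s k (B # \<Gamma>) \<Gamma>'"

lemma subst_var_typing:
  assumes "subst_var s k \<Gamma> \<Gamma>'" "ctx \<Gamma>'" "x < length \<Gamma>"
  shows "\<Gamma>' \<turnstile> subst k s (Var x) \<Ztypecolon> subst k s ((lift 0 ^^ Suc x) (\<Gamma> ! x))"
  using assms
proof (induction arbitrary: x rule: subst_var.induct)
  case (subst_0 \<Gamma> s A)
  then show ?case using ty_var[of \<Gamma> "x - 1"] by (cases x) auto
next
  case (subst_Suc s k \<Gamma> \<Gamma>' B)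
  show ?case
  proof (cases x)
    case 0
    then show ?thesis using ty_var[OF subst_Suc.prems(1), of 0] by simp
  next
    case (Suc y)
    with subst_Suc.prems have "ctx \<Gamma>'" "y < length \<Gamma>" by (auto dest: ctx_tail)
    from weakening(1)[OF subst_Suc.prems(1) subst_Suc.IH[OF this]]
    have "subst k s B # \<Gamma>' \<turnstile> subst (Suc k) (lift 0 s) (lift 0 (Var y))
        \<Ztypecolon> subst (Suc k) (lift 0 s) (lift 0 ((lift 0 ^^ Suc y) (\<Gamma> ! y)))"
      by (simp only: subst_Suc_lift[OF le0])
    with Suc show ?thesis by (simp del: lift_simps)
  qed
qed

lemma substitution_general:
  "ctx \<Gamma> \<Longrightarrow> subst_var s k \<Gamma> \<Gamma>' \<Longrightarrow> ctx \<Gamma>'"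
  "\<Gamma> \<turnstile> t \<Ztypecolon> T \<Longrightarrow> subst_var s k \<Gamma> \<Gamma>' \<Longrightarrow> \<Gamma>' \<turnstile> subst k s t \<Ztypecolon> subst k s T"
  "\<Gamma> \<turnstile> t \<simeq> u \<Ztypecolon> T \<Longrightarrow> subst_var s k \<Gamma> \<Gamma>' \<Longrightarrow> \<Gamma>' \<turnstile> subst k s t \<simeq> subst k s u \<Ztypecolon> subst k s T"
proof (induction arbitrary: s k \<Gamma>' and s k \<Gamma>' and s k \<Gamma>' rule: ctx_typing_eqtyping.inducts)
  case (ctx_cons \<Gamma> B i)
  from ctx_cons.prems show ?case
    by (rule subst_var_Cons)
      (use ctx_cons.hyps in \<open>auto intro: ctx_typing_eqtyping.ctx_cons ctx_cons.IH(1)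
        ctx_cons.IH(2)[simplified]\<close>)
next
  case (ty_var \<Gamma> x)
  then show ?case by (blast intro: subst_var_typing)
next
  case ty_conv
  then show ?case by (simp, blast intro: ctx_typing_eqtyping.ty_conv)
next
  case eq_conv
  then show ?case by (simp, blast intro: ctx_typing_eqtyping.eq_conv)
next
  case eq_sym
  then show ?case by (blast intro: ctx_typing_eqtyping.eq_sym)
next
  case eq_trans
  then show ?case by (blast intro: ctx_typing_eqtyping.eq_trans)
next
  case (con_comp t u \<Gamma> B)
  then show ?case by (blast intro: ctx_typing_eqtyping.con_comp computes_subst)
next
  case ctx_nil
  then show ?case by (blast elim: subst_var_Nil intro: ctx_typing_eqtyping.ctx_nil)
qed (simp_all add: subst_subst[OF le0], (blast intro: syntax_rules subst_Suc)+)

lemma substitution: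
  assumes "\<Gamma> \<turnstile> a \<Ztypecolon> A"
  shows "A # \<Gamma> \<turnstile> t \<Ztypecolon> T \<Longrightarrow> \<Gamma> \<turnstile> subst 0 a t \<Ztypecolon> subst 0 a T"
  using substitution_general(2) subst_0[OF assms] by blast

section \<open>Derived rules\<close>

text \<open>Lifting \<open>Suc k\<close> times at 0 amounts to lifting at \<open>k\<close> after
  \<open>k\<close> lifts at 0, so variable \<open>k\<close> does not occur in the result. The
  simplifier needs the explicit instances that follow, since it does not see nested lifts as a
  power.\<close>

lemma subst_lift_funpow: "subst k s ((lift 0 ^^ Suc k) t) = (lift 0 ^^ k) t"
proof -
  have "lift k ((lift 0 ^^ k) t) = (lift 0 ^^ Suc k) t"
    by (induction k) auto
  then show ?thesis by (metis subst_lift)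
qed

lemma subst_lifts [simp]:
  "subst (Suc 0) s (lift 0 (lift 0 t)) = lift 0 t"
  "subst (Suc (Suc 0)) s (lift 0 (lift 0 (lift 0 t))) = lift 0 (lift 0 t)"
  "subst (Suc (Suc (Suc 0))) s (lift 0 (lift 0 (lift 0 (lift 0 t)))) = lift 0 (lift 0 (lift 0 t))"
  "subst (Suc (Suc (Suc (Suc 0)))) s (lift 0 (lift 0 (lift 0 (lift 0 (lift 0 t))))) =
    lift 0 (lift 0 (lift 0 (lift 0 t)))"
  using subst_lift_funpow[of "Suc 0" s t] subst_lift_funpow[of "Suc (Suc 0)" s t]
    subst_lift_funpow[of "Suc (Suc (Suc 0))" s t] subst_lift_funpow[of "Suc (Suc (Suc (Suc 0)))"
        s t]
  by simp_all

lemma ctx_ext: "\<Gamma> \<turnstile> A \<Ztypecolon> Univ i \<Longrightarrow> ctx (A # \<Gamma>)"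
  by (blast intro: ctx_cons typing_ctx(2))

lemma wk: "\<Gamma> \<turnstile> B \<Ztypecolon> Univ i \<Longrightarrow> \<Gamma> \<turnstile> t \<Ztypecolon> T \<Longrightarrow> B # \<Gamma> \<turnstile> lift 0 t \<Ztypecolon> lift 0 T"
  by (blast intro: weakening ctx_ext)

lemma wk_ty: "\<Gamma> \<turnstile> B \<Ztypecolon> Univ i \<Longrightarrow> \<Gamma> \<turnstile> A \<Ztypecolon> Univ j \<Longrightarrow> B # \<Gamma> \<turnstile> lift 0 A \<Ztypecolon> Univ j"
  using wk[of \<Gamma> B i A "Univ j"] by simp

text \<open>Weakening of a body below its own bound variable, as happens when an abstraction is
  weakened. Followed by \<open>pi_beta\<close> at \<open>Var 0\<close> it gives back the
  body.\<close>

lemma wk1: "\<Gamma> \<turnstile> B \<Ztypecolon> Univ i \<Longrightarrow> A # \<Gamma> \<turnstile> t \<Ztypecolon> T \<Longrightarrow>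
    lift 0 A # B # \<Gamma> \<turnstile> lift (Suc 0) t \<Ztypecolon> lift (Suc 0) T"
  by (blast intro: weakening_general(2) insert_Suc insert_0 ctx_ext)

lemma var0: "\<Gamma> \<turnstile> A \<Ztypecolon> Univ i \<Longrightarrow> A # \<Gamma> \<turnstile> Var 0 \<Ztypecolon> lift 0 A"
  using ty_var[OF ctx_ext, of \<Gamma> A i 0] by simp

lemma app_arrow: "\<Gamma> \<turnstile> f \<Ztypecolon> Pi A (lift 0 B) \<Longrightarrow> \<Gamma> \<turnstile> a \<Ztypecolon> A \<Longrightarrow> \<Gamma> \<turnstile> App f a \<Ztypecolon> B"
  using ty_app[of \<Gamma> f A "lift 0 B" a] by simp

declare eq_trans [trans]

text \<open>The de Bruijn form of \<open>is_prop\<close>. It stays folded, and the two simp rules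
  below push \<open>lift\<close> and \<open>subst\<close> through it as through a constructor; later
  constructions follow this pattern.\<close>

definition IsProp :: "tm \<Rightarrow> tm" where
  "IsProp A = Pi A (Pi (lift 0 A) (Eq (lift 0 (lift 0 A)) (Var (Suc 0)) (Var 0)))"

lemma lift_IsProp [simp]: "lift k (IsProp A) = IsProp (lift k A)"
  by (simp add: IsProp_def)

lemma subst_IsProp [simp]: "subst k s (IsProp A) = IsProp (subst k s A)"
  by (simp add: IsProp_def)

lemma ty_IsProp:
  assumes "\<Gamma> \<turnstile> A \<Ztypecolon> Univ i"
  shows "\<Gamma> \<turnstile> IsProp A \<Ztypecolon> Univ i"
proof -
  note A1 = wk[OF assms assms, simplified]
  note A2 = wk_ty[OF A1 A1]
  show ?thesis
    using ty_pi[OF assms ty_pi[OF A1 ty_eq[OF A2 wk[OF A1 var0[OF assms], simplified] var0[OF A1]]]]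
    by (simp add: IsProp_def)
qed

lemma app_IsProp:
  assumes "\<Gamma> \<turnstile> h \<Ztypecolon> IsProp A" "\<Gamma> \<turnstile> a \<Ztypecolon> A" "\<Gamma> \<turnstile> b \<Ztypecolon> A"
  shows "\<Gamma> \<turnstile> App (App h a) b \<Ztypecolon> Eq A a b"
  using ty_app[OF ty_app[OF assms(1)[unfolded IsProp_def] assms(2), simplified] assms(3)] by simp

definition inhab :: "tm list \<Rightarrow> tm \<Rightarrow> bool" where
  "inhab \<Gamma> T \<longleftrightarrow> (\<exists>t. \<Gamma> \<turnstile> t \<Ztypecolon> T)"

lemma inhabI: "\<Gamma> \<turnstile> t \<Ztypecolon> T \<Longrightarrow> inhab \<Gamma> T"
  by (auto simp: inhab_def)

lemma inhab_conv: "inhab \<Gamma> A \<Longrightarrow> \<Gamma> \<turnstile> A \<simeq> B \<Ztypecolon> Univ i \<Longrightarrow> inhab \<Gamma> B"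
  by (auto simp: inhab_def intro: ty_conv)

lemma inhab_lam: "inhab (A # \<Gamma>) B \<Longrightarrow> inhab \<Gamma> (Pi A B)"
  by (auto simp: inhab_def intro: ty_lam)

section \<open>Identity types, extensionality and propositions\<close>

text \<open>\<open>IdInd\<close> takes its motive as a function, while the uses below have an open
  type \<open>M\<close> over an endpoint and a path; beta conversion passes between the two. The
  inhabitant is given explicitly because it occurs in the proof that a sum of propositions is a
  proposition, which the Kleisli extension contains.\<close>

lemma J:
  assumes A: "\<Gamma> \<turnstile> A \<Ztypecolon> Univ i" and a: "\<Gamma> \<turnstile> a \<Ztypecolon> A"
    and M: "Eq (lift 0 A) (lift 0 a) (Var 0) # A # \<Gamma> \<turnstile> M \<Ztypecolon> Univ j"
    and c: "\<Gamma> \<turnstile> c \<Ztypecolon> subst 0 (Refl a) (subst (Suc 0) (lift 0 a) M)"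
    and b: "\<Gamma> \<turnstile> b \<Ztypecolon> A" and p: "\<Gamma> \<turnstile> p \<Ztypecolon> Eq A a b"
  shows "\<Gamma> \<turnstile> apps (Con (IdInd i j)) [A, a, Lam A (Lam (Eq (lift 0 A) (lift 0 a) (Var 0)) M), c, b,
      p]
    \<Ztypecolon> subst 0 p (subst (Suc 0) (lift 0 b) M)"
proof -
  define C where "C = Lam A (Lam (Eq (lift 0 A) (lift 0 a) (Var 0)) M)"
  have C: "\<Gamma> \<turnstile> C \<Ztypecolon> Pi A (Pi (Eq (lift 0 A) (lift 0 a) (Var 0)) (Univ j))"
    unfolding C_def by (intro ty_lam M)
  \<comment> \<open>Needed twice: at \<open>a\<close> and \<open>Refl a\<close> to convert the type
    of \<open>c\<close>, and at the given endpoint and path for the conclusion.\<close>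
  have C_eq: "\<Gamma> \<turnstile> App (App C b) p \<simeq> subst 0 p (subst (Suc 0) (lift 0 b) M) \<Ztypecolon> Univ j"
    if b: "\<Gamma> \<turnstile> b \<Ztypecolon> A" and p: "\<Gamma> \<turnstile> p \<Ztypecolon> Eq A a b" for b p
  proof -
    have M': "Eq A a b # \<Gamma> \<turnstile> subst (Suc 0) (lift 0 b) M \<Ztypecolon> Univ j"
      using substitution_general(2)[OF M subst_Suc[OF subst_0[OF b]]] by simp
    have "\<Gamma> \<turnstile> App C b \<simeq> Lam (Eq A a b) (subst (Suc 0) (lift 0 b) M) \<Ztypecolon> Pi (Eq A a b) (Univ j)"
      using pi_beta[OF ty_lam[OF M] b] by (simp add: C_def)
    from eq_trans[OF eq_app[OF this eq_refl[OF p]] pi_beta[OF M' p]] show ?thesis by simp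
  qed
  have "\<Gamma> \<turnstile> Con (IdInd i j) \<Ztypecolon> con_type (IdInd i j) 0"
    by (rule ty_con) (rule typing_ctx(2)[OF A])
  \<comment> \<open>Unfolding the named syntax exposes the de Bruijn type of the constant, which is
    then applied to one argument after the other. The other constants are treated likewise.\<close>
  note 1 = ty_app[OF this[simplified sterm_defs con_type.simps, simplified] A, simplified]
  note 2 = ty_app[OF 1 a, simplified]
  note 3 = ty_app[OF 2 C, simplified]
  note 4 = ty_app[OF 3 ty_conv[OF c eq_sym[OF C_eq[OF a ty_refl[OF a]]]], simplified]
  note 5 = ty_app[OF 4 b, simplified]
  note 6 = ty_app[OF 5 p, simplified]
  from ty_conv[OF 6 C_eq[OF b p]] show ?thesis by (simp add: C_def)
qed

text \<open>Identity induction with a motive that ignores the path. Inhabitation is enough here,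
  because no later type mentions a transported proof.\<close>

lemma transport:
  assumes A: "\<Gamma> \<turnstile> A \<Ztypecolon> Univ i" and ab: "\<Gamma> \<turnstile> a \<Ztypecolon> A" "\<Gamma> \<turnstile> b \<Ztypecolon> A"
    and p: "inhab \<Gamma> (Eq A a b)" and M: "A # \<Gamma> \<turnstile> M \<Ztypecolon> Univ j" and c: "inhab \<Gamma> (subst 0 a M)"
  shows "inhab \<Gamma> (subst 0 b M)"
proof -
  from p c obtain p c where p: "\<Gamma> \<turnstile> p \<Ztypecolon> Eq A a b" and c: "\<Gamma> \<turnstile> c \<Ztypecolon> subst 0 a M"
    by (auto simp: inhab_def)
  have "A # \<Gamma> \<turnstile> Eq (lift 0 A) (lift 0 a) (Var 0) \<Ztypecolon> Univ i"
    using ty_eq[OF wk_ty[OF A A] wk[OF A ab(1)] var0[OF A]] by simp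
  note M' = wk[OF this M, simplified]
  from J[OF A ab(1) M' _ ab(2) p] c show ?thesis by (auto intro: inhabI)
qed

lemma funext:
  assumes A: "\<Gamma> \<turnstile> A \<Ztypecolon> Univ i" and B: "A # \<Gamma> \<turnstile> B \<Ztypecolon> Univ j"
    and f: "\<Gamma> \<turnstile> f \<Ztypecolon> Pi A B" and g: "\<Gamma> \<turnstile> g \<Ztypecolon> Pi A B"
    and e: "inhab (A # \<Gamma>) (Eq B (App (lift 0 f) (Var 0)) (App (lift 0 g) (Var 0)))"
  shows "inhab \<Gamma> (Eq (Pi A B) f g)"
proof -
  \<comment> \<open>\<open>FunExt\<close> quantifies over families given as functions, so
    \<open>B\<close> is abstracted and the types of \<open>f\<close>, \<open>g\<close> and the
    homotopy are converted by beta.\<close>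
  define L where "L = Lam A B"
  have L: "\<Gamma> \<turnstile> L \<Ztypecolon> Pi A (Univ j)"
    unfolding L_def by (intro ty_lam B)
  have eqB: "A # \<Gamma> \<turnstile> B \<simeq> App (lift 0 L) (Var 0) \<Ztypecolon> Univ j"
    using eq_sym[OF pi_beta[OF wk1[OF A B] var0[OF A]]] by (simp add: L_def)
  have eqPi: "\<Gamma> \<turnstile> Pi A B \<simeq> Pi A (App (lift 0 L) (Var 0)) \<Ztypecolon> Univ (max i j)"
    by (rule eq_pi[OF eq_refl[OF A] eqB])
  from e obtain t where t: "A # \<Gamma> \<turnstile> t \<Ztypecolon> Eq B (App (lift 0 f) (Var 0)) (App (lift 0 g) (Var 0))"
    by (auto simp: inhab_def)
  have "A # \<Gamma> \<turnstile> App (lift 0 h) (Var 0) \<Ztypecolon> B" if "\<Gamma> \<turnstile> h \<Ztypecolon> Pi A B" for h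
    using ty_app[OF wk[OF A that, simplified] var0[OF A]] by simp
  note t' = ty_lam[OF ty_conv[OF t eq_eq[OF eqB eq_refl[OF this[OF f]] eq_refl[OF this[OF g]]]]]
  have "\<Gamma> \<turnstile> Con (FunExt i j) \<Ztypecolon> con_type (FunExt i j) 0"
    by (rule ty_con) (rule typing_ctx(2)[OF A])
  note 1 = ty_app[OF this[simplified sterm_defs con_type.simps, simplified] A, simplified]
  note 2 = ty_app[OF 1 L, simplified]
  note 3 = ty_app[OF 2 ty_conv[OF f eqPi], simplified]
  note 4 = ty_app[OF 3 ty_conv[OF g eqPi], simplified]
  note 5 = ty_app[OF 4 t', simplified]
  have "\<Gamma> \<turnstile> Eq (Pi A (App (lift 0 L) (Var 0))) f g \<simeq> Eq (Pi A B) f g \<Ztypecolon> Univ (max i j)"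
    by (rule eq_sym[OF eq_eq[OF eqPi eq_refl[OF f] eq_refl[OF g]]])
  from ty_conv[OF 5 this] show ?thesis by (rule inhabI)
qed

lemma propext:
  assumes P: "\<Gamma> \<turnstile> P \<Ztypecolon> Univ i" and Q: "\<Gamma> \<turnstile> Q \<Ztypecolon> Univ i"
    and h: "inhab \<Gamma> (IsProp P)" "inhab \<Gamma> (IsProp Q)"
    and f: "inhab (P # \<Gamma>) (lift 0 Q)" and g: "inhab (Q # \<Gamma>) (lift 0 P)"
  shows "inhab \<Gamma> (Eq (Univ i) P Q)"
proof -
  from h inhab_lam[OF f] inhab_lam[OF g] obtain hP hQ f g where
    h: "\<Gamma> \<turnstile> hP \<Ztypecolon> IsProp P" "\<Gamma> \<turnstile> hQ \<Ztypecolon> IsProp Q"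
    and f: "\<Gamma> \<turnstile> f \<Ztypecolon> Pi P (lift 0 Q)" and g: "\<Gamma> \<turnstile> g \<Ztypecolon> Pi Q (lift 0 P)"
    by (auto simp: inhab_def)
  have "\<Gamma> \<turnstile> Con (PropExt i) \<Ztypecolon> con_type (PropExt i) 0"
    by (rule ty_con) (rule typing_ctx(2)[OF P])
  note 1 = ty_app[OF this[simplified sterm_defs con_type.simps, simplified] P, simplified]
  note 2 = ty_app[OF 1 Q, simplified]
  note 3 = ty_app[OF 2 h(1)[unfolded IsProp_def], simplified]
  note 4 = ty_app[OF 3 h(2)[unfolded IsProp_def], simplified]
  note 5 = ty_app[OF 4 f, simplified]
  note 6 = ty_app[OF 5 g, simplified]
  from 6 show ?thesis by (rule inhabI)
qed

text \<open>For \<open>h : IsProp A\<close>, identity induction on \<open>h x x\<close> gives \<open>F : \<Pi> y\<in>A. x = y \<rightarrow> x = y\<close> with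
  \<open>F x (h x x) = refl\<close>; then every \<open>p : x = y\<close> equals \<open>F y (h x y)\<close>.\<close>

lemma prop_is_set:
  assumes A: "\<Gamma> \<turnstile> A \<Ztypecolon> Univ i" and h: "\<Gamma> \<turnstile> h \<Ztypecolon> IsProp A"
    and x: "\<Gamma> \<turnstile> x \<Ztypecolon> A" and y: "\<Gamma> \<turnstile> y \<Ztypecolon> A"
    and p: "\<Gamma> \<turnstile> p \<Ztypecolon> Eq A x y" and q: "\<Gamma> \<turnstile> q \<Ztypecolon> Eq A x y"
  shows "inhab \<Gamma> (Eq (Eq A x y) p q)"
proof -
  let ?A1 = "lift 0 A" let ?A2 = "lift 0 ?A1" let ?A3 = "lift 0 ?A2" let ?A4 = "lift 0 ?A3"
  let ?x1 = "lift 0 x" let ?x2 = "lift 0 ?x1" let ?x3 = "lift 0 ?x2"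
  note A1 = wk_ty[OF A A]
  note x1 = wk[OF A x]
  have E1: "A # \<Gamma> \<turnstile> Eq ?A1 ?x1 (Var 0) \<Ztypecolon> Univ i"
    by (rule ty_eq[OF A1 x1 var0[OF A]])
  let ?\<Gamma>2 = "Eq ?A1 ?x1 (Var 0) # A # \<Gamma>"
  note A2 = wk_ty[OF E1 A1]
  note x2 = wk[OF E1 x1, simplified]
  have y2: "?\<Gamma>2 \<turnstile> Var (Suc 0) \<Ztypecolon> ?A2"
    using wk[OF E1 var0[OF A]] by simp
  have r2: "?\<Gamma>2 \<turnstile> Var 0 \<Ztypecolon> Eq ?A2 ?x2 (Var (Suc 0))"
    using var0[OF E1] by simp

  let ?F = "\<lambda>A x z. Pi A (Pi (Eq (lift 0 A) (lift 0 x) (Var 0)) (Eq (lift 0 (lift 0 A)) (lift 0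
      (lift 0 z)) (Var (Suc 0))))"
  have tyF: "\<Delta> \<turnstile> ?F A x z \<Ztypecolon> Univ i"
    if A: "\<Delta> \<turnstile> A \<Ztypecolon> Univ i" and x: "\<Delta> \<turnstile> x \<Ztypecolon> A" and z: "\<Delta> \<turnstile> z \<Ztypecolon> A" for \<Delta> A x z
  proof -
    note A1 = wk_ty[OF A A]
    note E1 = ty_eq[OF A1 wk[OF A x] var0[OF A]]
    note A2 = wk_ty[OF E1 A1]
    have "Eq (lift 0 A) (lift 0 x) (Var 0) # A # \<Delta> \<turnstile> Var (Suc 0) \<Ztypecolon> lift 0 (lift 0 A)"
      using wk[OF E1 var0[OF A]] by simp
    from ty_pi[OF A ty_pi[OF E1 ty_eq[OF A2 wk[OF E1 wk[OF A z]] this]]] show ?thesis by simp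
  qed

  \<comment> \<open>The motive for an induction on r : x = z: a map F sending paths x = y to paths z
    = y, with F z r = refl. It behaves like composition with the inverse of r, so that symmetry,
    transitivity and their laws need not be developed.\<close>
  let ?S = "\<lambda>A x z r. Sig (?F A x z) (Eq (Eq (lift 0 A) (lift 0 z) (lift 0 z)) (App (App (Var 0)
      (lift 0 z)) (lift 0 r)) (Refl (lift 0 z)))"
  have tyS: "?\<Gamma>2 \<turnstile> ?S ?A2 ?x2 (Var (Suc 0)) (Var 0) \<Ztypecolon> Univ i"
  proof -
    note F = tyF[OF A2 x2 y2, simplified]
    note z3 = wk[OF F y2, simplified]
    have "Pi ?A2 (Pi (Eq ?A3 ?x3 (Var 0)) (Eq ?A4 (Var (Suc (Suc (Suc 0)))) (Var (Suc 0)))) #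
        ?\<Gamma>2 \<turnstile> App (App (Var 0) (Var (Suc (Suc 0)))) (Var (Suc 0))
          \<Ztypecolon> Eq ?A3 (Var (Suc (Suc 0))) (Var (Suc (Suc 0)))"
      using ty_app[OF ty_app[OF var0[OF F, simplified] z3, simplified] wk[OF F r2, simplified]]
        by simp
    from ty_sig[OF F ty_eq[OF ty_eq[OF wk_ty[OF F A2, simplified] z3 z3] this ty_refl[OF z3]]]
        show ?thesis by simp
  qed
  \<comment> \<open>The base case r = refl, where the identity map serves as F.\<close>
  let ?I = "Lam A (Lam (Eq ?A1 ?x1 (Var 0)) (Var 0))"
  have I: "\<Gamma> \<turnstile> ?I \<Ztypecolon> ?F A x x"
    using ty_lam[OF ty_lam[OF r2]] by simp
  have I_eq: "\<Gamma> \<turnstile> App (App ?I x) (Refl x) \<simeq> Refl x \<Ztypecolon> Eq A x x"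
  proof -
    have 1: "\<Gamma> \<turnstile> App ?I x \<simeq> Lam (Eq A x x) (Var 0) \<Ztypecolon> Pi (Eq A x x) (lift 0 (Eq A x x))"
      using pi_beta[OF ty_lam[OF r2] x] by simp
    have 2: "\<Gamma> \<turnstile> App (Lam (Eq A x x) (Var 0)) (Refl x) \<simeq> Refl x \<Ztypecolon> Eq A x x"
      using pi_beta[OF var0[OF ty_eq[OF A x x]] ty_refl[OF x]] by simp
    from eq_trans[OF eq_app[OF 1 eq_refl[OF ty_refl[OF x]], simplified] 2] show ?thesis by simp
  qed
  have base: "inhab \<Gamma> (?S A x x (Refl x))"
  proof -
    have S: "?F A x x # \<Gamma> \<turnstile> Eq (Eq ?A1 ?x1 ?x1) (App (App (Var 0) ?x1) (Refl ?x1)) (Refl ?x1)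
        \<Ztypecolon> Univ i"
    proof -
      note F = tyF[OF A x x]
      note x1 = wk[OF F x]
      have "?F A x x # \<Gamma> \<turnstile> App (App (Var 0) ?x1) (Refl ?x1) \<Ztypecolon> Eq ?A1 ?x1 ?x1"
        using ty_app[OF ty_app[OF var0[OF F, simplified] x1, simplified] ty_refl[OF x1]] by simp
      from ty_eq[OF ty_eq[OF wk_ty[OF F A] x1 x1] this ty_refl[OF x1]] show ?thesis .
    qed
    have "\<Gamma> \<turnstile> Refl (Refl x) \<Ztypecolon> Eq (Eq A x x) (App (App ?I x) (Refl x)) (Refl x)"
      using ty_conv[OF ty_refl[OF ty_refl[OF x]]
          eq_eq[OF eq_refl[OF ty_eq[OF A x x]] eq_sym[OF I_eq] eq_refl[OF ty_refl[OF x]]]] .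
    then show ?thesis using ty_pair[OF S I, of "Refl (Refl x)"] by (auto intro: inhabI)
  qed
  have "inhab \<Gamma> (?S A x x (App (App h x) x))"
    using base J[OF A x tyS _ x app_IsProp[OF h x x]] by (auto simp: inhab_def)
  then obtain t where t: "\<Gamma> \<turnstile> t \<Ztypecolon> ?S A x x (App (App h x) x)"
    by (auto simp: inhab_def)
  define F where "F = Fst t"
  have F: "\<Gamma> \<turnstile> F \<Ztypecolon> ?F A x x"
    using ty_fst[OF t] by (simp add: F_def)
  have Fr: "\<Gamma> \<turnstile> Snd t \<Ztypecolon> Eq (Eq A x x) (App (App F x) (App (App h x) x)) (Refl x)"
    using ty_snd[OF t] by (simp add: F_def)
  \<comment> \<open>Induction on \<open>p\<close>. At reflexivity the claim is the equation
    \<open>Fr\<close> that comes with \<open>F\<close>.\<close>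
  have Fp: "inhab \<Gamma> (Eq (Eq A x y) (App (App F y) (App (App h x) y)) p)"
    if p: "\<Gamma> \<turnstile> p \<Ztypecolon> Eq A x y" for p
  proof -
    have h2: "?\<Gamma>2 \<turnstile> lift 0 (lift 0 h) \<Ztypecolon> IsProp ?A2"
      using wk[OF E1 wk[OF A h]] by simp
    have F2: "?\<Gamma>2 \<turnstile> lift 0 (lift 0 F) \<Ztypecolon> ?F ?A2 ?x2 ?x2"
      using wk[OF E1 wk[OF A F]] by simp
    have Fh: "?\<Gamma>2 \<turnstile> App (App (lift 0 (lift 0 F)) (Var (Suc 0))) (App (App (lift 0 (lift 0 h)) ?x2)
        (Var (Suc 0)))
        \<Ztypecolon> Eq ?A2 ?x2 (Var (Suc 0))"
      using ty_app[OF ty_app[OF F2 y2, simplified] app_IsProp[OF h2 x2 y2]] by simp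
    from J[OF A x ty_eq[OF ty_eq[OF A2 x2 y2] Fh r2] _ y p] Fr show ?thesis
      by (auto simp: inhab_def)
  qed
  note E = ty_eq[OF A x y]
  have c: "\<Gamma> \<turnstile> App (App F y) (App (App h x) y) \<Ztypecolon> Eq A x y"
    using ty_app[OF ty_app[OF F y, simplified] app_IsProp[OF h x y]] by simp
  from transport[OF E c p Fp[OF p] ty_eq[OF wk_ty[OF E E] var0[OF E] wk[OF E q]]] Fp[OF q]
  show ?thesis by simp
qed

text \<open>Both proofs assign to each pair of points a path in \<open>A\<close>, and parallel paths
  in a proposition agree by \<open>prop_is_set\<close>. Function extensionality, once per argument,
  lifts this to the proofs.\<close>

lemma prop_IsProp:
  assumes A: "\<Gamma> \<turnstile> A \<Ztypecolon> Univ i" and h: "\<Gamma> \<turnstile> h \<Ztypecolon> IsProp A" and h': "\<Gamma> \<turnstile> h' \<Ztypecolon> IsProp A"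
  shows "inhab \<Gamma> (Eq (IsProp A) h h')"
proof -
  note A1 = wk_ty[OF A A]
  note A2 = wk_ty[OF A1 A1]
  have x: "lift 0 A # A # \<Gamma> \<turnstile> Var (Suc 0) \<Ztypecolon> lift 0 (lift 0 A)"
    using wk[OF A1 var0[OF A]] by simp
  note y = var0[OF A1]
  note E = ty_eq[OF A2 x y]
  have app: "A # \<Gamma> \<turnstile> App (lift 0 h) (Var 0) \<Ztypecolon> Pi (lift 0 A) (Eq (lift 0 (lift 0 A)) (Var (Suc 0))
      (Var 0))"
    if "\<Gamma> \<turnstile> h \<Ztypecolon> IsProp A" for h
    using ty_app[OF wk[OF A that, simplified, unfolded IsProp_def] var0[OF A]] by simp
  have app2: "lift 0 A # A # \<Gamma> \<turnstile> lift 0 (lift 0 h) \<Ztypecolon> IsProp (lift 0 (lift 0 A))"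
      if "\<Gamma> \<turnstile> h \<Ztypecolon> IsProp A" for h
    using wk[OF A1 wk[OF A that]] by simp
  have "inhab (A # \<Gamma>) (Eq (Pi (lift 0 A) (Eq (lift 0 (lift 0 A)) (Var (Suc 0)) (Var 0)))
      (App (lift 0 h) (Var 0)) (App (lift 0 h') (Var 0)))"
    using prop_is_set[OF A2 app2[OF h] x y app_IsProp[OF app2[OF h] x y] app_IsProp[OF app2[OF h']
        x y]]
    by (intro funext[OF A1 E app[OF h] app[OF h']]) simp
  from funext[OF A ty_pi[OF A1 E] h[unfolded IsProp_def] h'[unfolded IsProp_def] this]
  show ?thesis by (simp add: IsProp_def)
qed

section \<open>Partial elements\<close>

text \<open>\<open>Lift\<close> and \<open>Lift_d\<close> as de Bruijn terms; \<open>W\<close> is the type of the proof component and lives under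
  one additional variable, the domain of definition.\<close>

definition Partial :: "nat \<Rightarrow> tm \<Rightarrow> tm \<Rightarrow> tm" where
  "Partial n W Y = Sig (Univ n) (Sig W (Pi (Var (Suc 0)) (lift 0 (lift 0 (lift 0 Y)))))"

definition LiftTm :: "nat \<Rightarrow> tm \<Rightarrow> tm" where
  "LiftTm n Y = Partial n (IsProp (Var 0)) Y"

definition LiftdTm :: "nat \<Rightarrow> tm \<Rightarrow> tm \<Rightarrow> tm" where
  "LiftdTm n d Y = Partial n (App (lift 0 d) (Var 0)) Y"

lemma lift_LiftTm [simp]: "lift k (LiftTm n Y) = LiftTm n (lift k Y)"
  by (simp add: LiftTm_def Partial_def)

lemma subst_LiftTm [simp]: "subst k s (LiftTm n Y) = LiftTm n (subst k s Y)"
  by (simp add: LiftTm_def Partial_def)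

lemma lift_LiftdTm [simp]: "lift k (LiftdTm n d Y) = LiftdTm n (lift k d) (lift k Y)"
  by (simp add: LiftdTm_def Partial_def)

lemma subst_LiftdTm [simp]: "subst k s (LiftdTm n d Y) = LiftdTm n (subst k s d) (subst k s Y)"
  by (simp add: LiftdTm_def Partial_def)

text \<open>Serves both kinds of partial element at once: typing of the three projections, formation
  of triples and their computation depend on \<open>W\<close> merely as a family over
  \<open>Univ n\<close>.\<close>

locale Partial_family =
  fixes n \<Gamma> W Y
  assumes W: "Univ n # \<Gamma> \<turnstile> W \<Ztypecolon> Univ n" and Y: "\<Gamma> \<turnstile> Y \<Ztypecolon> Univ n"
begin

lemma ty_U: "\<Gamma> \<turnstile> Univ n \<Ztypecolon> Univ (Suc n)"
  by (rule ty_univ) (rule typing_ctx(2)[OF Y])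

lemma ty_inner:
  "Univ n # \<Gamma> \<turnstile> Sig W (Pi (Var (Suc 0)) (lift 0 (lift 0 (lift 0 Y)))) \<Ztypecolon> Univ n"
proof -
  have P: "W # Univ n # \<Gamma> \<turnstile> Var (Suc 0) \<Ztypecolon> Univ n"
    using wk_ty[OF W var0[OF ty_U, simplified]] by simp
  from ty_sig[OF W ty_pi[OF P wk_ty[OF P wk_ty[OF W wk_ty[OF ty_U Y]]]]] show ?thesis by simp
qed

lemma ty_Partial: "\<Gamma> \<turnstile> Partial n W Y \<Ztypecolon> Univ (Suc n)"
  using ty_sig[OF ty_U ty_inner] by (simp add: Partial_def max_def)

lemma ty_defined: "\<Gamma> \<turnstile> u \<Ztypecolon> Partial n W Y \<Longrightarrow> \<Gamma> \<turnstile> Fst u \<Ztypecolon> Univ n"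
  unfolding Partial_def by (rule ty_fst)

lemma ty_witness: "\<Gamma> \<turnstile> u \<Ztypecolon> Partial n W Y \<Longrightarrow> \<Gamma> \<turnstile> Fst (Snd u) \<Ztypecolon> subst 0 (Fst u) W"
  unfolding Partial_def by (drule ty_snd) (auto intro: ty_fst)

lemma ty_val: "\<Gamma> \<turnstile> u \<Ztypecolon> Partial n W Y \<Longrightarrow> \<Gamma> \<turnstile> Snd (Snd u) \<Ztypecolon> Pi (Fst u) (lift 0 Y)"
  unfolding Partial_def by (drule ty_snd) (auto dest: ty_snd)

context
  fixes P h v
  assumes P: "\<Gamma> \<turnstile> P \<Ztypecolon> Univ n" and h: "\<Gamma> \<turnstile> h \<Ztypecolon> subst 0 P W" and v: "\<Gamma> \<turnstile> v \<Ztypecolon> Pi P (lift 0 Y)"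
begin

lemma ty_subst_W: "\<Gamma> \<turnstile> subst 0 P W \<Ztypecolon> Univ n"
  using substitution[OF P W] by simp

lemma ty_PY: "subst 0 P W # \<Gamma> \<turnstile> Pi (lift 0 P) (lift 0 (lift 0 Y)) \<Ztypecolon> Univ n"
  using wk_ty[OF ty_subst_W ty_pi[OF P wk_ty[OF P Y]]] by simp

lemma ty_pair_inner: "\<Gamma> \<turnstile> Pr h v \<Ztypecolon> Sig (subst 0 P W) (Pi (lift 0 P) (lift 0 (lift 0 Y)))"
  using ty_pair[OF ty_PY h] v by simp

lemma ty_Partial_pair: "\<Gamma> \<turnstile> Pr P (Pr h v) \<Ztypecolon> Partial n W Y"
  unfolding Partial_def using ty_pair[OF ty_inner P] ty_pair_inner by simp

lemma defined_beta: "\<Gamma> \<turnstile> Fst (Pr P (Pr h v)) \<simeq> P \<Ztypecolon> Univ n"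
  using sig_beta1[OF ty_inner P] ty_pair_inner by simp

lemma val_beta: "\<Gamma> \<turnstile> Snd (Snd (Pr P (Pr h v))) \<simeq> v \<Ztypecolon> Pi P (lift 0 Y)"
proof -
  have "\<Gamma> \<turnstile> Snd (Pr P (Pr h v)) \<simeq> Pr h v \<Ztypecolon> Sig (subst 0 P W) (Pi (lift 0 P) (lift 0 (lift 0 Y)))"
    using sig_beta2[OF ty_inner P] ty_pair_inner by simp
  from eq_trans[OF eq_snd[OF this, simplified], of v] sig_beta2[OF ty_PY h] v show ?thesis by simp
qed

lemma Partial_pair_eq:
  assumes P': "\<Gamma> \<turnstile> P \<simeq> P' \<Ztypecolon> Univ n" and v': "\<Gamma> \<turnstile> v \<simeq> v' \<Ztypecolon> Pi P (lift 0 Y)"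
  shows "\<Gamma> \<turnstile> Pr P (Pr h v) \<simeq> Pr P' (Pr h v') \<Ztypecolon> Partial n W Y"
proof -
  have "\<Gamma> \<turnstile> Pr h v \<simeq> Pr h v' \<Ztypecolon> Sig (subst 0 P W) (Pi (lift 0 P) (lift 0 (lift 0 Y)))"
    using eq_pair[OF ty_PY eq_refl[OF h]] v' by simp
  then show ?thesis unfolding Partial_def using eq_pair[OF ty_inner P'] by simp
qed

end

end

lemma eq_IsProp:
  assumes e: "\<Gamma> \<turnstile> A \<simeq> A' \<Ztypecolon> Univ i" and A: "\<Gamma> \<turnstile> A \<Ztypecolon> Univ i"
  shows "\<Gamma> \<turnstile> IsProp A \<simeq> IsProp A' \<Ztypecolon> Univ i"
proof -
  note A1 = wk_ty[OF A A]
  have x: "lift 0 A # A # \<Gamma> \<turnstile> Var (Suc 0) \<Ztypecolon> lift 0 (lift 0 A)"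
    using wk[OF A1 var0[OF A]] by simp
  have e1: "A # \<Gamma> \<turnstile> lift 0 A \<simeq> lift 0 A' \<Ztypecolon> Univ i"
    using weakening(2)[OF ctx_ext[OF A] e] by simp
  have e2: "lift 0 A # A # \<Gamma> \<turnstile> lift 0 (lift 0 A) \<simeq> lift 0 (lift 0 A') \<Ztypecolon> Univ i"
    using weakening(2)[OF ctx_ext[OF A1] e1] by simp
  from eq_pi[OF e eq_pi[OF e1 eq_eq[OF e2 eq_refl[OF x] eq_refl[OF var0[OF A1]]]]]
  show ?thesis by (simp add: IsProp_def)
qed

lemma LiftTm_family: "\<Gamma> \<turnstile> Y \<Ztypecolon> Univ n \<Longrightarrow> Partial_family n \<Gamma> (IsProp (Var 0)) Y"
  using ty_IsProp[OF var0[OF ty_univ, simplified]] typing_ctx(2) by unfold_locales auto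

lemma LiftdTm_family:
  assumes d: "\<Gamma> \<turnstile> d \<Ztypecolon> Pi (Univ n) (Univ n)" and Y: "\<Gamma> \<turnstile> Y \<Ztypecolon> Univ n"
  shows "Partial_family n \<Gamma> (App (lift 0 d) (Var 0)) Y"
proof
  note ty_U = ty_univ[OF typing_ctx(2)[OF Y], of n]
  show "Univ n # \<Gamma> \<turnstile> App (lift 0 d) (Var 0) \<Ztypecolon> Univ n"
    using ty_app[OF wk[OF ty_U d, simplified] var0[OF ty_U, simplified]] by simp
qed (rule Y)

text \<open>Reflexivity is transported along the path from \<open>h\<close> to \<open>h'\<close>.
  This is how proof components are exchanged later, once domain and value have been made to agree
  judgementally.\<close>

lemma lift_path:
  assumes Y: "\<Gamma> \<turnstile> Y \<Ztypecolon> Univ n" and P: "\<Gamma> \<turnstile> P \<Ztypecolon> Univ n"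
    and h: "\<Gamma> \<turnstile> h \<Ztypecolon> IsProp P" and h': "\<Gamma> \<turnstile> h' \<Ztypecolon> IsProp P" and v: "\<Gamma> \<turnstile> v \<Ztypecolon> Pi P (lift 0 Y)"
  shows "inhab \<Gamma> (Eq (LiftTm n Y) (Pr P (Pr h v)) (Pr P (Pr h' v)))"
proof -
  interpret L: Partial_family n \<Gamma> "IsProp (Var 0)" Y by (rule LiftTm_family[OF Y])
  note T = ty_IsProp[OF P]
  interpret L1: Partial_family n "IsProp P # \<Gamma>" "IsProp (Var 0)" "lift 0 Y"
      by (rule LiftTm_family[OF wk_ty[OF T Y]])
  have pr: "\<Gamma> \<turnstile> Pr P (Pr h v) \<Ztypecolon> LiftTm n Y"
    using L.ty_Partial_pair[OF P _ v] h by (simp add: LiftTm_def)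
  have "IsProp P # \<Gamma> \<turnstile> Pr (lift 0 P) (Pr (Var 0) (lift 0 v)) \<Ztypecolon> LiftTm n (lift 0 Y)"
    using L1.ty_Partial_pair[OF wk_ty[OF T P] _ wk[OF T v, simplified]] var0[OF T]
        by (simp add: LiftTm_def)
  note M = ty_eq[OF L1.ty_Partial[folded LiftTm_def] wk[OF T pr, simplified] this]
  from transport[OF T h h' prop_IsProp[OF P h h'] M] inhabI[OF ty_refl[OF pr]] show ?thesis by simp
qed

section \<open>Composition and the embedding of partial elements\<close>

definition Comp :: "tm \<Rightarrow> tm \<Rightarrow> tm \<Rightarrow> tm" where
  "Comp A g f = Lam A (App (lift 0 g) (App (lift 0 f) (Var 0)))"

lemma lift_Comp [simp]: "lift k (Comp A g f) = Comp (lift k A) (lift k g) (lift k f)"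
  by (simp add: Comp_def)

lemma subst_Comp [simp]: "subst k s (Comp A g f) = Comp (subst k s A) (subst k s g) (subst k s f)"
  by (simp add: Comp_def)

context
  fixes \<Gamma> A i f B g C
  assumes A: "\<Gamma> \<turnstile> A \<Ztypecolon> Univ i" and f: "\<Gamma> \<turnstile> f \<Ztypecolon> Pi A (lift 0 B)" and g: "\<Gamma> \<turnstile> g \<Ztypecolon> Pi B (lift 0 C)"
begin

lemma Comp_body: "A # \<Gamma> \<turnstile> App (lift 0 g) (App (lift 0 f) (Var 0)) \<Ztypecolon> lift 0 C"
  using app_arrow[OF wk[OF A g, simplified] app_arrow[OF wk[OF A f, simplified] var0[OF A]]] .

lemma ty_Comp: "\<Gamma> \<turnstile> Comp A g f \<Ztypecolon> Pi A (lift 0 C)"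
  unfolding Comp_def by (rule ty_lam[OF Comp_body])

lemma Comp_beta: "\<Gamma> \<turnstile> a \<Ztypecolon> A \<Longrightarrow> \<Gamma> \<turnstile> App (Comp A g f) a \<simeq> App g (App f a) \<Ztypecolon> C"
  unfolding Comp_def using pi_beta[OF Comp_body, of a] by simp

end

definition Incl :: "nat \<Rightarrow> tm \<Rightarrow> tm \<Rightarrow> tm \<Rightarrow> tm" where
  "Incl n d s Y = Lam (LiftdTm n d Y) (Pr (Fst (Var 0))
    (Pr (App (App (Snd (lift 0 s)) (Fst (Var 0))) (Fst (Snd (Var 0)))) (Snd (Snd (Var 0)))))"

lemma lift_Incl [simp]: "lift k (Incl n d s Y) = Incl n (lift k d) (lift k s) (lift k Y)"
  by (simp add: Incl_def)

lemma subst_Incl [simp]: "subst k t (Incl n d s Y) = Incl n (subst k t d) (subst k t s)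
    (subst k t Y)"
  by (simp add: Incl_def)

lemma ty_LiftTm: "\<Gamma> \<turnstile> Y \<Ztypecolon> Univ n \<Longrightarrow> \<Gamma> \<turnstile> LiftTm n Y \<Ztypecolon> Univ (Suc n)"
  unfolding LiftTm_def by (rule Partial_family.ty_Partial[OF LiftTm_family])

text \<open>The second assumption is the implication from d X to X being a proposition, which the
  embedding applies to witnesses. The context is a parameter, so \<open>weaken\<close> yields
  instances under further binders.\<close>

locale prop_set =
  fixes n \<Gamma> d s
  assumes d: "\<Gamma> \<turnstile> d \<Ztypecolon> Pi (Univ n) (Univ n)"
    and s: "\<Gamma> \<turnstile> Snd s \<Ztypecolon> Pi (Univ n) (Pi (App (lift 0 d) (Var 0)) (IsProp (Var (Suc 0))))"
begin

lemma ty_U: "\<Gamma> \<turnstile> Univ n \<Ztypecolon> Univ (Suc n)"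
  by (rule ty_univ) (rule typing_ctx(2)[OF d])

lemma ty_d: "\<Gamma> \<turnstile> P \<Ztypecolon> Univ n \<Longrightarrow> \<Gamma> \<turnstile> App d P \<Ztypecolon> Univ n"
  using ty_app[OF d, of P] by simp

lemma eq_d: "\<Gamma> \<turnstile> P \<simeq> Q \<Ztypecolon> Univ n \<Longrightarrow> \<Gamma> \<turnstile> App d P \<simeq> App d Q \<Ztypecolon> Univ n"
  using eq_app[OF eq_refl[OF d], of P Q] by simp

lemma d_is_prop:
  "\<Gamma> \<turnstile> P \<Ztypecolon> Univ n \<Longrightarrow> \<Gamma> \<turnstile> k \<Ztypecolon> App d P \<Longrightarrow> \<Gamma> \<turnstile> App (App (Snd s) P) k \<Ztypecolon> IsProp P"
  using ty_app[OF ty_app[OF s, of P, simplified], of k] by simp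

lemma weaken:
  assumes "\<Gamma> \<turnstile> B \<Ztypecolon> Univ i"
  shows "prop_set n (B # \<Gamma>) (lift 0 d) (lift 0 s)"
  using wk[OF assms d] wk[OF assms s] by unfold_locales simp_all

lemma ty_LiftdTm: "\<Gamma> \<turnstile> Y \<Ztypecolon> Univ n \<Longrightarrow> \<Gamma> \<turnstile> LiftdTm n d Y \<Ztypecolon> Univ (Suc n)"
  unfolding LiftdTm_def by (rule Partial_family.ty_Partial[OF LiftdTm_family[OF d]])

context
  fixes Y assumes Y: "\<Gamma> \<turnstile> Y \<Ztypecolon> Univ n"
begin

interpretation D: Partial_family n \<Gamma> "App (lift 0 d) (Var 0)" Y by (rule LiftdTm_family[OF d Y])

lemma LiftdTm_defined: "\<Gamma> \<turnstile> v \<Ztypecolon> LiftdTm n d Y \<Longrightarrow> \<Gamma> \<turnstile> Fst v \<Ztypecolon> Univ n"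
  and LiftdTm_witness: "\<Gamma> \<turnstile> v \<Ztypecolon> LiftdTm n d Y \<Longrightarrow> \<Gamma> \<turnstile> Fst (Snd v) \<Ztypecolon> App d (Fst v)"
  and LiftdTm_val: "\<Gamma> \<turnstile> v \<Ztypecolon> LiftdTm n d Y \<Longrightarrow> \<Gamma> \<turnstile> Snd (Snd v) \<Ztypecolon> Pi (Fst v) (lift 0 Y)"
  using D.ty_defined[of v] D.ty_witness[of v] D.ty_val[of v] by (simp_all add: LiftdTm_def)

lemma ty_LiftdTm_pair:
  "\<Gamma> \<turnstile> P \<Ztypecolon> Univ n \<Longrightarrow> \<Gamma> \<turnstile> k \<Ztypecolon> App d P \<Longrightarrow> \<Gamma> \<turnstile> v \<Ztypecolon> Pi P (lift 0 Y) \<Longrightarrow> \<Gamma> \<turnstile> Pr P (Pr k v) \<Ztypecolon> LiftdTm n d Y"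
  using D.ty_Partial_pair[of P k v] by (simp add: LiftdTm_def)

lemma LiftdTm_defined_beta:
  "\<Gamma> \<turnstile> P \<Ztypecolon> Univ n \<Longrightarrow> \<Gamma> \<turnstile> k \<Ztypecolon> App d P \<Longrightarrow> \<Gamma> \<turnstile> v \<Ztypecolon> Pi P (lift 0 Y) \<Longrightarrow> \<Gamma> \<turnstile> Fst (Pr P (Pr k v)) \<simeq> P
      \<Ztypecolon> Univ n"
  using D.defined_beta[of P k v] by simp

end

lemma ty_Incl_body:
  assumes Y: "\<Gamma> \<turnstile> Y \<Ztypecolon> Univ n" and v: "\<Gamma> \<turnstile> v \<Ztypecolon> LiftdTm n d Y"
  shows "\<Gamma> \<turnstile> Pr (Fst v) (Pr (App (App (Snd s) (Fst v)) (Fst (Snd v))) (Snd (Snd v))) \<Ztypecolon> LiftTm n Y"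
proof -
  interpret L: Partial_family n \<Gamma> "IsProp (Var 0)" Y by (rule LiftTm_family[OF Y])
  show ?thesis
    using L.ty_Partial_pair[OF LiftdTm_defined[OF Y v] _ LiftdTm_val[OF Y v]] d_is_prop[OF
        LiftdTm_defined[OF Y v] LiftdTm_witness[OF Y v]]
    by (simp add: LiftTm_def)
qed

lemma Incl:
  assumes Y: "\<Gamma> \<turnstile> Y \<Ztypecolon> Univ n"
  shows ty_Incl: "\<Gamma> \<turnstile> Incl n d s Y \<Ztypecolon> Pi (LiftdTm n d Y) (lift 0 (LiftTm n Y))"
    and Incl_beta: "\<Gamma> \<turnstile> v \<Ztypecolon> LiftdTm n d Y \<Longrightarrow> \<Gamma> \<turnstile> App (Incl n d s Y) v \<simeq>
      Pr (Fst v) (Pr (App (App (Snd s) (Fst v)) (Fst (Snd v))) (Snd (Snd v))) \<Ztypecolon> LiftTm n Y"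
proof -
  note T = ty_LiftdTm[OF Y]
  note b = prop_set.ty_Incl_body[OF weaken[OF T] wk_ty[OF T Y] var0[OF T, simplified]]
  from ty_lam[OF b] show "\<Gamma> \<turnstile> Incl n d s Y \<Ztypecolon> Pi (LiftdTm n d Y) (lift 0 (LiftTm n Y))"
    by (simp add: Incl_def)
  show "\<Gamma> \<turnstile> App (Incl n d s Y) v \<simeq>
      Pr (Fst v) (Pr (App (App (Snd s) (Fst v)) (Fst (Snd v))) (Snd (Snd v))) \<Ztypecolon> LiftTm n Y"
    if "\<Gamma> \<turnstile> v \<Ztypecolon> LiftdTm n d Y"
    using pi_beta[OF b that] by (simp add: Incl_def)
qed

lemma Incl_defined:
  assumes Y: "\<Gamma> \<turnstile> Y \<Ztypecolon> Univ n" and v: "\<Gamma> \<turnstile> v \<Ztypecolon> LiftdTm n d Y"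
  shows "\<Gamma> \<turnstile> Fst (App (Incl n d s Y) v) \<simeq> Fst v \<Ztypecolon> Univ n"
proof -
  interpret L: Partial_family n \<Gamma> "IsProp (Var 0)" Y by (rule LiftTm_family[OF Y])
  note eq_fst[OF Incl_beta[OF Y v, unfolded LiftTm_def Partial_def]]
  moreover have "\<Gamma> \<turnstile> Fst (Pr (Fst v) (Pr (App (App (Snd s) (Fst v)) (Fst (Snd v))) (Snd (Snd v))))
      \<simeq> Fst v \<Ztypecolon> Univ n"
    using L.defined_beta[OF LiftdTm_defined[OF Y v] _ LiftdTm_val[OF Y v]] d_is_prop[OF
        LiftdTm_defined[OF Y v] LiftdTm_witness[OF Y v]]
    by simp
  ultimately show ?thesis by (rule eq_trans)
qed

text \<open>Beta reduces domain and value to \<open>P\<close> and \<open>v\<close>. The proof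
  component is built from projections of the pair and typed over \<open>Fst\<close> of it; after
  conversion its existence suffices, because \<open>lift_path\<close> will exchange it.\<close>

lemma Incl_pair_eq:
  assumes Y: "\<Gamma> \<turnstile> Y \<Ztypecolon> Univ n" and P: "\<Gamma> \<turnstile> P \<Ztypecolon> Univ n" and k: "\<Gamma> \<turnstile> k \<Ztypecolon> App d P"
    and v: "\<Gamma> \<turnstile> v \<Ztypecolon> Pi P (lift 0 Y)"
  shows "\<exists>h. \<Gamma> \<turnstile> h \<Ztypecolon> IsProp P \<and> \<Gamma> \<turnstile> App (Incl n d s Y) (Pr P (Pr k v)) \<simeq> Pr P (Pr h v) \<Ztypecolon> LiftTm n Y"
proof -
  interpret L: Partial_family n \<Gamma> "IsProp (Var 0)" Y by (rule LiftTm_family[OF Y])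
  interpret D: Partial_family n \<Gamma> "App (lift 0 d) (Var 0)" Y by (rule LiftdTm_family[OF d Y])
  let ?x = "Pr P (Pr k v)"
  let ?h = "App (App (Snd s) (Fst ?x)) (Fst (Snd ?x))"
  note x = ty_LiftdTm_pair[OF Y P k v]
  note Px = LiftdTm_defined[OF Y x]
  have h: "\<Gamma> \<turnstile> ?h \<Ztypecolon> IsProp (Fst ?x)"
    by (rule d_is_prop[OF Px LiftdTm_witness[OF Y x]])
  have PP: "\<Gamma> \<turnstile> Fst ?x \<simeq> P \<Ztypecolon> Univ n"
    by (rule LiftdTm_defined_beta[OF Y P k v])
  have "\<Gamma> \<turnstile> Pi P (lift 0 Y) \<simeq> Pi (Fst ?x) (lift 0 Y) \<Ztypecolon> Univ n"
    using eq_pi[OF eq_sym[OF PP] eq_refl[OF wk_ty[OF P Y]]] by simp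
  then have "\<Gamma> \<turnstile> Snd (Snd ?x) \<simeq> v \<Ztypecolon> Pi (Fst ?x) (lift 0 Y)"
    using eq_conv[OF D.val_beta[OF P _ v]] k by simp
  then have "\<Gamma> \<turnstile> Pr (Fst ?x) (Pr ?h (Snd (Snd ?x))) \<simeq> Pr P (Pr ?h v) \<Ztypecolon> LiftTm n Y"
    using L.Partial_pair_eq[OF Px _ LiftdTm_val[OF Y x] PP] h by (simp add: LiftTm_def)
  with eq_trans[OF Incl_beta[OF Y x]] ty_conv[OF h eq_IsProp[OF PP Px]] show ?thesis by blast
qed

text \<open>The factor keeps \<open>P\<close> and \<open>v\<close> and puts the proof
  \<open>k\<close> in place of \<open>h\<close>. Composing with the embedding restores a proof of
  propositionhood, possibly different from \<open>h\<close>; \<open>lift_path\<close> identifies the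
  two pointwise and function extensionality does so globally.\<close>

lemma factor_intro:
  assumes A: "\<Gamma> \<turnstile> A \<Ztypecolon> Univ i" and Y: "\<Gamma> \<turnstile> Y \<Ztypecolon> Univ n" and F: "\<Gamma> \<turnstile> F \<Ztypecolon> Pi A (lift 0 (LiftTm n Y))"
    and P: "A # \<Gamma> \<turnstile> P \<Ztypecolon> Univ n" and h: "A # \<Gamma> \<turnstile> h \<Ztypecolon> IsProp P"
    and v: "A # \<Gamma> \<turnstile> v \<Ztypecolon> Pi P (lift 0 (lift 0 Y))"
    and F_eq: "A # \<Gamma> \<turnstile> App (lift 0 F) (Var 0) \<simeq> Pr P (Pr h v) \<Ztypecolon> lift 0 (LiftTm n Y)"
    and k: "inhab (A # \<Gamma>) (App (lift 0 d) P)"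
  shows "\<exists>e. \<Gamma> \<turnstile> e \<Ztypecolon> Pi A (lift 0 (LiftdTm n d Y)) \<and>
    inhab \<Gamma> (Eq (Pi A (lift 0 (LiftTm n Y))) (Comp A (Incl n d s Y) e) F)"
proof -
  from k obtain k where k: "A # \<Gamma> \<turnstile> k \<Ztypecolon> App (lift 0 d) P" by (auto simp: inhab_def)
  interpret A: prop_set n "A # \<Gamma>" "lift 0 d" "lift 0 s" by (rule weaken[OF A])
  note Y1 = wk_ty[OF A Y]
  let ?x = "Pr P (Pr k v)"
  define e where "e = Lam A ?x"
  note x = A.ty_LiftdTm_pair[OF Y1 P k v]
  have e: "\<Gamma> \<turnstile> e \<Ztypecolon> Pi A (lift 0 (LiftdTm n d Y))"
    using ty_lam[OF x] by (simp add: e_def)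
  have e_eq: "A # \<Gamma> \<turnstile> App (lift 0 e) (Var 0) \<simeq> ?x \<Ztypecolon> LiftdTm n (lift 0 d) (lift 0 Y)"
    using pi_beta[OF wk1[OF A x] var0[OF A]] by (simp add: e_def)
  obtain h' where h': "A # \<Gamma> \<turnstile> h' \<Ztypecolon> IsProp P"
    and I: "A # \<Gamma> \<turnstile> App (Incl n (lift 0 d) (lift 0 s) (lift 0 Y)) ?x \<simeq> Pr P (Pr h' v)
        \<Ztypecolon> LiftTm n (lift 0 Y)"
    using A.Incl_pair_eq[OF Y1 P k v] by blast
  note C = ty_Comp[OF A e ty_Incl[OF Y]]
  have "A # \<Gamma> \<turnstile> App (lift 0 (Comp A (Incl n d s Y) e)) (Var 0) \<simeq>
      App (Incl n (lift 0 d) (lift 0 s) (lift 0 Y)) (App (lift 0 e) (Var 0)) \<Ztypecolon> LiftTm n (lift 0 Y)"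
    using Comp_beta[OF wk_ty[OF A A] _ A.ty_Incl[OF Y1] var0[OF A], of "lift 0 e"] wk[OF A e]
        by simp
  also note eq_app[OF eq_refl[OF A.ty_Incl[OF Y1]] e_eq, simplified]
  also note I
  finally have "A # \<Gamma> \<turnstile> App (lift 0 (Comp A (Incl n d s Y) e)) (Var 0) \<simeq> Pr P (Pr h' v)
      \<Ztypecolon> LiftTm n (lift 0 Y)" .
  note c = eq_eq[OF eq_refl[OF ty_LiftTm[OF Y1]] eq_sym[OF this] eq_sym[OF F_eq[simplified]]]
  have "inhab (A # \<Gamma>) (Eq (lift 0 (LiftTm n Y)) (App (lift 0 (Comp A (Incl n d s Y) e)) (Var 0))
      (App (lift 0 F) (Var 0)))"
    using inhab_conv[OF lift_path[OF Y1 P h' h v] c] by simp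
  from funext[OF A wk_ty[OF A ty_LiftTm[OF Y]] C F this] e show ?thesis by blast
qed

text \<open>The domain of the composite at \<open>a\<close> is judgementally that of
  \<open>e\<close> at \<open>a\<close>, whose witness is available. The motive takes a function and
  evaluates it at \<open>a\<close>, so one transport along the given path of functions is
  enough.\<close>

lemma factor_elim:
  assumes A: "\<Gamma> \<turnstile> A \<Ztypecolon> Univ i" and Y: "\<Gamma> \<turnstile> Y \<Ztypecolon> Univ n" and F: "\<Gamma> \<turnstile> F \<Ztypecolon> Pi A (lift 0 (LiftTm n Y))"
    and e: "\<Gamma> \<turnstile> e \<Ztypecolon> Pi A (lift 0 (LiftdTm n d Y))"
    and p: "inhab \<Gamma> (Eq (Pi A (lift 0 (LiftTm n Y))) (Comp A (Incl n d s Y) e) F)"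
    and a: "\<Gamma> \<turnstile> a \<Ztypecolon> A"
  shows "inhab \<Gamma> (App d (Fst (App F a)))"
proof -
  let ?T = "Pi A (lift 0 (LiftTm n Y))"
  have T: "\<Gamma> \<turnstile> ?T \<Ztypecolon> Univ (max i (Suc n))"
    by (rule ty_pi[OF A wk_ty[OF A ty_LiftTm[OF Y]]])
  note C = ty_Comp[OF A e ty_Incl[OF Y]]
  interpret T: prop_set n "?T # \<Gamma>" "lift 0 d" "lift 0 s" by (rule weaken[OF T])
  interpret L: Partial_family n "?T # \<Gamma>" "IsProp (Var 0)" "lift 0 Y"
      by (rule LiftTm_family[OF wk_ty[OF T Y]])
  have "?T # \<Gamma> \<turnstile> App (Var 0) (lift 0 a) \<Ztypecolon> Partial n (IsProp (Var 0)) (lift 0 Y)"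
    using app_arrow[OF _ wk[OF T a], of "Var 0" "LiftTm n (lift 0 Y)"] var0[OF T]
        by (simp add: LiftTm_def[symmetric])
  note M = T.ty_d[OF L.ty_defined[OF this]]
  note ea = app_arrow[OF e a]
  have "\<Gamma> \<turnstile> App (Comp A (Incl n d s Y) e) a \<simeq> App (Incl n d s Y) (App e a) \<Ztypecolon> LiftTm n Y"
    by (rule Comp_beta[OF A e ty_Incl[OF Y] a])
  from eq_trans[OF eq_fst[OF this[unfolded LiftTm_def Partial_def]] Incl_defined[OF Y ea]]
  have "\<Gamma> \<turnstile> App d (Fst (App e a)) \<simeq> App d (Fst (App (Comp A (Incl n d s Y) e) a)) \<Ztypecolon> Univ n"
    by (rule eq_d[OF eq_sym])
  with inhabI[OF LiftdTm_witness[OF Y ea]] have "inhab \<Gamma> (App d (Fst (App (Comp A (Incl n d s Y)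
      e) a)))"
    by (rule inhab_conv)
  with transport[OF T C F p M] show ?thesis by simp
qed

end

section \<open>Sums of propositions\<close>

text \<open>The body of \<open>sigma_prop\<close>; \<open>h\<close> and \<open>r\<close> are the proofs that it obtains from \<open>hQ\<close> and \<open>hP\<close>.\<close>

definition sigma_path :: "nat \<Rightarrow> tm \<Rightarrow> tm \<Rightarrow> tm \<Rightarrow> tm \<Rightarrow> tm \<Rightarrow> tm \<Rightarrow> tm" where
  "sigma_path n P B h r v w =
    (let S = Sig P B; v1 = lift 0 v; v2 = lift 0 v1; v3 = lift 0 v2;
      S3 = lift 0 (lift 0 (lift 0 S)); Q = subst 0 (Fst v) B; Q1 = lift 0 Q in
    App (apps (Con (IdInd n n))
      [P, Fst v,
       Lam P (Lam (Eq (lift 0 P) (Fst v1) (Var 0)) (Pi (lift 0 B) (Eq S3 v3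
         (Pr (Var (Suc (Suc 0))) (Var 0))))),
       Lam Q (apps (Con (IdInd n n))
         [Q1, Snd v1,
          Lam Q1 (Lam (Eq (lift 0 Q1) (Snd v2) (Var 0)) (Eq S3 v3 (Pr (Fst v3) (Var (Suc 0))))),
          Refl v1, Var 0, App (App (lift 0 h) (Snd v1)) (Var 0)]),
       Fst w, r]) (Snd w))"

text \<open>Induction on \<open>r\<close> reduces to a common first component, where
  \<open>h\<close> gives a path between second components; induction on that path leaves
  reflexivity, by eta for pairs. The outer motive quantifies over second components because their
  type varies with the endpoint.\<close>

lemma ty_sigma_path:
  assumes P: "\<Gamma> \<turnstile> P \<Ztypecolon> Univ n" and B: "P # \<Gamma> \<turnstile> B \<Ztypecolon> Univ n"
    and v: "\<Gamma> \<turnstile> v \<Ztypecolon> Sig P B" and w: "\<Gamma> \<turnstile> w \<Ztypecolon> Sig P B"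
    and h: "\<Gamma> \<turnstile> h \<Ztypecolon> IsProp (subst 0 (Fst v) B)" and r: "\<Gamma> \<turnstile> r \<Ztypecolon> Eq P (Fst v) (Fst w)"
  shows "\<Gamma> \<turnstile> sigma_path n P B h r v w \<Ztypecolon> Eq (Sig P B) v w"
proof -
  define Q where "Q = subst 0 (Fst v) B"
  define S where "S = Sig P B"
  let ?v1 = "lift 0 v" let ?v2 = "lift 0 ?v1" let ?v3 = "lift 0 ?v2"
  let ?S1 = "lift 0 S" let ?S2 = "lift 0 ?S1" let ?S3 = "lift 0 ?S2"
  have S: "\<Gamma> \<turnstile> S \<Ztypecolon> Univ n"
    using ty_sig[OF P B] by (simp add: S_def)
  have vS: "\<Gamma> \<turnstile> v \<Ztypecolon> S"
    using v by (simp add: S_def)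
  note fv = ty_fst[OF v]
  have Q: "\<Gamma> \<turnstile> Q \<Ztypecolon> Univ n"
    using substitution[OF fv B] by (simp add: Q_def)
  have sv: "\<Gamma> \<turnstile> Snd v \<Ztypecolon> Q"
    using ty_snd[OF v] by (simp add: Q_def)
  \<comment> \<open>The general laws do not fire by themselves: the simplifier first moves
    \<open>lift\<close> inside \<open>Fst\<close>, and the substituted term is no longer literally a
    lift. The next fact has the same purpose.\<close>
  have subst_B: "subst (Suc 0) (Fst (lift 0 a)) (lift 0 B) = lift 0 (subst 0 (Fst a) B)" for a
    using subst_Suc_lift[of 0 0 "Fst a" B] by (simp del: lift_simps)
  have lift_Q: "subst 0 (Fst (lift 0 a)) (lift (Suc 0) C) = lift 0 (subst 0 (Fst a) C)" for a C
    using lift_subst[of 0 0 "Fst a" C] by simp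
  have pair3: "X3 # X2 # X1 # \<Gamma> \<turnstile> Pr a b \<Ztypecolon> ?S3"
    if X: "\<Gamma> \<turnstile> X1 \<Ztypecolon> Univ n" "X1 # \<Gamma> \<turnstile> X2 \<Ztypecolon> Univ n" "X2 # X1 # \<Gamma> \<turnstile> X3 \<Ztypecolon> Univ n"
      and a: "X3 # X2 # X1 # \<Gamma> \<turnstile> a \<Ztypecolon> lift 0 (lift 0 (lift 0 P))"
      and b: "X3 # X2 # X1 # \<Gamma> \<turnstile> b \<Ztypecolon> subst 0 a (lift (Suc 0) (lift (Suc 0) (lift (Suc 0) B)))"
    for X1 X2 X3 a b
    using ty_pair[OF _ a b] wk1[OF X(3) wk1[OF X(2) wk1[OF X(1) B]]] by (simp add: S_def)

  let ?inner = "apps (Con (IdInd n n))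
         [lift 0 Q, Snd ?v1,
          Lam (lift 0 Q) (Lam (Eq (lift 0 (lift 0 Q)) (Snd ?v2) (Var 0)) (Eq ?S3 ?v3 (Pr (Fst ?v3)
            (Var (Suc 0))))),
          Refl ?v1, Var 0, App (App (lift 0 h) (Snd ?v1)) (Var 0)]"
  have inner: "Q # \<Gamma> \<turnstile> ?inner \<Ztypecolon> Eq ?S1 ?v1 (Pr (Fst ?v1) (Var 0))"
  proof -
    note Q1 = wk_ty[OF Q Q]
    note sv1 = wk[OF Q sv, simplified]
    note v1 = wk[OF Q vS] note S1 = wk_ty[OF Q S]
    let ?E = "Eq (lift 0 (lift 0 Q)) (lift 0 (Snd ?v1)) (Var 0)"
    have E: "lift 0 Q # Q # \<Gamma> \<turnstile> ?E \<Ztypecolon> Univ n"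
      by (rule ty_eq[OF wk_ty[OF Q1 Q1] wk[OF Q1 sv1] var0[OF Q1]])
    have "?E # lift 0 Q # Q # \<Gamma> \<turnstile> Pr (Fst ?v3) (Var (Suc 0)) \<Ztypecolon> ?S3"
    proof (rule pair3[OF Q Q1 E])
      show "?E # lift 0 Q # Q # \<Gamma> \<turnstile> Fst ?v3 \<Ztypecolon> lift 0 (lift 0 (lift 0 P))"
        using wk[OF E wk[OF Q1 wk[OF Q fv]]] by simp
      show "?E # lift 0 Q # Q # \<Gamma> \<turnstile> Var (Suc 0) \<Ztypecolon> subst 0 (Fst ?v3) (lift (Suc 0) (lift (Suc 0)
        (lift (Suc 0) B)))"
        using wk[OF E var0[OF Q1]] by (simp add: lift_Q Q_def)
    qed
    note M = ty_eq[OF wk_ty[OF E wk_ty[OF Q1 S1]] wk[OF E wk[OF Q1 v1]] this]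
    have "\<Gamma> \<turnstile> Pr (Fst v) (Snd v) \<simeq> v \<Ztypecolon> S"
      using sig_eta[OF v] by (simp add: S_def)
    from weakening(2)[OF ctx_ext[OF Q] this]
    have c: "Q # \<Gamma> \<turnstile> Refl ?v1 \<Ztypecolon> Eq ?S1 ?v1 (Pr (Fst ?v1) (Snd ?v1))"
      using ty_conv[OF ty_refl[OF v1] eq_eq[OF eq_refl[OF S1] eq_refl[OF v1] eq_sym]] by simp
    have p: "Q # \<Gamma> \<turnstile> App (App (lift 0 h) (Snd ?v1)) (Var 0) \<Ztypecolon> Eq (lift 0 Q) (Snd ?v1) (Var 0)"
      using app_IsProp[OF _ sv1 var0[OF Q]] wk[OF Q h] by (simp add: Q_def)
    from J[OF Q1 sv1 M _ var0[OF Q] p] c show ?thesis by simp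
  qed

  have outer: "\<Gamma> \<turnstile> apps (Con (IdInd n n))
      [P, Fst v,
       Lam P (Lam (Eq (lift 0 P) (lift 0 (Fst v)) (Var 0)) (Pi (lift 0 B) (Eq ?S3 ?v3
         (Pr (Var (Suc (Suc 0))) (Var 0))))),
       Lam Q ?inner, Fst w, r] \<Ztypecolon> Pi (subst 0 (Fst w) B) (Eq ?S1 ?v1 (Pr (Fst (lift 0 w)) (Var 0)))"
  proof -
    let ?E = "Eq (lift 0 P) (lift 0 (Fst v)) (Var 0)"
    have E: "P # \<Gamma> \<turnstile> ?E \<Ztypecolon> Univ n"
      by (rule ty_eq[OF wk_ty[OF P P] wk[OF P fv] var0[OF P]])
    note B1 = wk_ty[OF E B]
    have "lift 0 B # ?E # P # \<Gamma> \<turnstile> Pr (Var (Suc (Suc 0))) (Var 0) \<Ztypecolon> ?S3"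
    proof (rule pair3[OF P E B1])
      show "lift 0 B # ?E # P # \<Gamma> \<turnstile> Var (Suc (Suc 0)) \<Ztypecolon> lift 0 (lift 0 (lift 0 P))"
        using wk[OF B1 wk[OF E var0[OF P]]] by simp
      show "lift 0 B # ?E # P # \<Gamma> \<turnstile> Var 0 \<Ztypecolon> subst 0 (Var (Suc (Suc 0))) (lift (Suc 0)
        (lift (Suc 0) (lift (Suc 0) B)))"
        using var0[OF B1] by simp
    qed
    from ty_pi[OF B1 ty_eq[OF wk_ty[OF B1 wk_ty[OF E wk_ty[OF P S]]] wk[OF B1 wk[OF E wk[OF P
        vS]]] this]]
    have M: "?E # P # \<Gamma> \<turnstile> Pi (lift 0 B) (Eq ?S3 ?v3 (Pr (Var (Suc (Suc 0))) (Var 0))) \<Ztypecolon> Univ n"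
        by simp
    from J[OF P fv M _ ty_fst[OF w] r] ty_lam[OF inner] show ?thesis by (simp add: subst_B Q_def)
  qed
  from ty_app[OF outer ty_snd[OF w]]
  have "\<Gamma> \<turnstile> sigma_path n P B h r v w \<Ztypecolon> Eq S v (Pr (Fst w) (Snd w))"
    by (simp add: sigma_path_def Let_def Q_def S_def[symmetric] del: lift.simps(7))
  from ty_conv[OF this eq_eq[OF eq_refl[OF S] eq_refl[OF vS]]] sig_eta[OF w] show ?thesis
    by (simp add: S_def)
qed

lemma (in prop_set) d_sigma:
  assumes clo: "\<And>P Q. \<Gamma> \<turnstile> P \<Ztypecolon> Univ n \<Longrightarrow> \<Gamma> \<turnstile> Q \<Ztypecolon> Univ n \<Longrightarrow> inhab \<Gamma> (App d P) \<Longrightarrow>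
      inhab (P # \<Gamma>) (lift 0 (App d Q)) \<Longrightarrow> inhab \<Gamma> (App d (Sig P (lift 0 Q)))"
    and P: "\<Gamma> \<turnstile> P \<Ztypecolon> Univ n" and B: "P # \<Gamma> \<turnstile> B \<Ztypecolon> Univ n"
    and S_prop: "inhab \<Gamma> (IsProp (Sig P B))"
    and dP: "inhab \<Gamma> (App d P)" and dB: "inhab (P # \<Gamma>) (App (lift 0 d) B)"
  shows "inhab \<Gamma> (App d (Sig P B))"
proof -
  let ?S = "Sig P B" let ?S1 = "lift 0 ?S" let ?S2 = "lift 0 ?S1"
  have S: "\<Gamma> \<turnstile> ?S \<Ztypecolon> Univ n"
    using ty_sig[OF P B] by simp
  interpret P: prop_set n "P # \<Gamma>" "lift 0 d" "lift 0 s" by (rule weaken[OF P])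
  have is_prop: "inhab \<Gamma> (IsProp R)" if "\<Gamma> \<turnstile> R \<Ztypecolon> Univ n" "inhab \<Gamma> (App d R)" for R
    using that d_is_prop by (auto simp: inhab_def)
  \<comment> \<open>Stated for any context because it is used twice: under p : P to pass from the
    fibre to the sum, and at the end to pass from the product to the sum.\<close>
  have d_transport: "inhab \<Gamma> (App d R')"
    if "prop_set n \<Gamma> d s" "\<Gamma> \<turnstile> R \<Ztypecolon> Univ n" "\<Gamma> \<turnstile> R' \<Ztypecolon> Univ n" "inhab \<Gamma> (Eq (Univ n) R R')"
        "inhab \<Gamma> (App d R)"
    for \<Gamma> d s R R'
  proof -
    interpret prop_set n \<Gamma> d s by fact
    interpret L: prop_set n "Univ n # \<Gamma>" "lift 0 d" "lift 0 s" by (rule weaken[OF ty_U])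
    from transport[OF ty_U that(2-4) L.ty_d[OF var0[OF ty_U, simplified]]] that(5) show ?thesis
        by simp
  qed
  note S1 = wk_ty[OF P S]
  note P1 = wk_ty[OF P P]
  obtain hP where hP: "\<Gamma> \<turnstile> hP \<Ztypecolon> IsProp P" using is_prop[OF P dP] by (auto simp: inhab_def)
  have dS1: "inhab (P # \<Gamma>) (lift 0 (App d ?S))"
  proof -
    have B_prop: "inhab (P # \<Gamma>) (IsProp B)"
      using dB P.d_is_prop[OF B] by (auto simp: inhab_def)
    have S1_prop: "inhab (P # \<Gamma>) (IsProp ?S1)"
      using S_prop wk[OF P] by (force simp: inhab_def)
    have to: "inhab (B # P # \<Gamma>) ?S2"
    proof -
      have "B # P # \<Gamma> \<turnstile> Var (Suc 0) \<Ztypecolon> lift 0 (lift 0 P)"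
        using wk[OF B var0[OF P]] by simp
      with ty_pair[OF wk1[OF B wk1[OF P B], simplified]] var0[OF B] show ?thesis
        by (fastforce intro: inhabI)
    qed
    \<comment> \<open>An element w of the sum has its second component over \<open>Fst\<close> w,
      not over the given p. Propositionhood of \<open>P\<close> supplies the path along which it is
      transported.\<close>
    have "from": "inhab (?S1 # P # \<Gamma>) (lift 0 B)"
    proof -
      note P2 = wk_ty[OF S1 P1]
      have w: "?S1 # P # \<Gamma> \<turnstile> Var 0 \<Ztypecolon> ?S2"
        by (rule var0[OF S1])
      have p: "?S1 # P # \<Gamma> \<turnstile> Var (Suc 0) \<Ztypecolon> lift 0 (lift 0 P)"
        using wk[OF S1 var0[OF P]] by simp
      have hP2: "?S1 # P # \<Gamma> \<turnstile> lift 0 (lift 0 hP) \<Ztypecolon> IsProp (lift 0 (lift 0 P))"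
        using wk[OF S1 wk[OF P hP]] by simp
      note fw = ty_fst[OF w[simplified]]
      from transport[OF P2 _ p inhabI[OF app_IsProp[OF hP2 _ p]], of "Fst (Var 0)"] 
        fw wk1[OF S1 wk1[OF P B]] ty_snd[OF w[simplified]]
      show ?thesis by (fastforce intro: inhabI)
    qed
    from d_transport[OF P.prop_set_axioms B S1 propext[OF B S1 B_prop S1_prop to "from"] dB]
    show ?thesis by simp
  qed
  let ?R = "Sig P ?S1"
  have R: "\<Gamma> \<turnstile> ?R \<Ztypecolon> Univ n"
    using ty_sig[OF P S1] by simp
  have dR: "inhab \<Gamma> (App d ?R)"
    by (rule clo[OF P S dP dS1])
  \<comment> \<open>The second projection, stated for a variable \<open>T\<close> so that the
    simplifier leaves \<open>lift 0 T\<close> intact instead of pushing the lift into a concrete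
    sum.\<close>
  have "inhab (Sig P (lift 0 T) # \<Gamma>) (lift 0 T)" if "\<Gamma> \<turnstile> Sig P (lift 0 T) \<Ztypecolon> Univ n" for T
    using ty_snd[OF var0[OF that, simplified]] by (auto intro!: inhabI)
  from this[OF R] have "inhab (?R # \<Gamma>) ?S1" .
  moreover have "inhab (?S # \<Gamma>) (lift 0 ?R)"
  proof -
    note w = var0[OF S]
    \<comment> \<open>An element w of the sum is sent to the pair of its first component and w
      itself.\<close>
    have "?S # \<Gamma> \<turnstile> Pr (Fst (Var 0)) (Var 0) \<Ztypecolon> Sig (lift 0 P) (lift 0 ?S1)"
      using ty_pair[OF wk_ty[OF wk_ty[OF S P] wk_ty[OF S S]] ty_fst[OF w[simplified]]] w by simp
    then show ?thesis by (auto simp: lift_lift intro: inhabI)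
  qed
  ultimately have "inhab \<Gamma> (Eq (Univ n) ?R ?S)"
    by (intro propext[OF R S is_prop[OF R dR] S_prop])
  from d_transport[OF prop_set_axioms R S this dR] show ?thesis .
qed

section \<open>Kleisli extension and unit\<close>

definition kl_defined :: "tm \<Rightarrow> tm \<Rightarrow> tm" where
  "kl_defined g u = Sig (Fst u) (Fst (App (lift 0 g) (App (Snd (Snd (lift 0 u))) (Var 0))))"

lemma lift_kl_defined [simp]: "lift k (kl_defined g u) = kl_defined (lift k g) (lift k u)"
  by (simp add: kl_defined_def)

lemma subst_kl_defined [simp]: "subst k s (kl_defined g u) = kl_defined (subst k s g) (subst k s u)"
  by (simp add: kl_defined_def)

text \<open>\<open>sigma_prop\<close> at the domain of \<open>g\<close> after \<open>u\<close>. The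
  index arithmetic has to agree literally with the named version under its two abstractions, because
  the two are finally compared as terms.\<close>

definition kl_witness :: "nat \<Rightarrow> tm \<Rightarrow> tm \<Rightarrow> tm" where
  "kl_witness n g u = Lam (kl_defined g u) (Lam (kl_defined (lift 0 g) (lift 0 u))
    (sigma_path n (Fst (lift 0 (lift 0 u)))
      (Fst (App (lift 0 (lift 0 (lift 0 g))) (App (Snd (Snd (lift 0 (lift 0 (lift 0 u)))))
        (Var 0))))
      (Fst (Snd (App (lift 0 (lift 0 g)) (App (Snd (Snd (lift 0 (lift 0 u))))
        (Fst (Var (Suc 0)))))))
      (App (App (Fst (Snd (lift 0 (lift 0 u)))) (Fst (Var (Suc 0)))) (Fst (Var 0)))
      (Var (Suc 0)) (Var 0)))"

lemma lift_kl_witness [simp]: "lift k (kl_witness n g u) = kl_witness n (lift k g) (lift k u)"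
  by (simp add: kl_witness_def sigma_path_def Let_def)

lemma subst_kl_witness [simp]: "subst k s (kl_witness n g u) = kl_witness n (subst k s g) (subst k
    s u)"
  by (simp add: kl_witness_def sigma_path_def Let_def)

definition kl_val :: "tm \<Rightarrow> tm \<Rightarrow> tm" where
  "kl_val g u = Lam (kl_defined g u) (App (Snd (Snd (App (lift 0 g) (App (Snd (Snd (lift 0 u)))
      (Fst (Var 0)))))) (Snd (Var 0)))"

lemma lift_kl_val [simp]: "lift k (kl_val g u) = kl_val (lift k g) (lift k u)"
  by (simp add: kl_val_def)

lemma subst_kl_val [simp]: "subst k s (kl_val g u) = kl_val (subst k s g) (subst k s u)"
  by (simp add: kl_val_def)

definition Kleisli :: "nat \<Rightarrow> tm \<Rightarrow> tm \<Rightarrow> tm" where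
  "Kleisli n X g = Lam (LiftTm n X) (Pr (kl_defined (lift 0 g) (Var 0)) (Pr (kl_witness n (lift 0
      g) (Var 0)) (kl_val (lift 0 g) (Var 0))))"

lemma lift_Kleisli [simp]: "lift k (Kleisli n X g) = Kleisli n (lift k X) (lift k g)"
  by (simp add: Kleisli_def)

lemma subst_Kleisli [simp]: "subst k s (Kleisli n X g) = Kleisli n (subst k s X) (subst k s g)"
  by (simp add: Kleisli_def)

context
  fixes n \<Gamma> Y assumes Y: "\<Gamma> \<turnstile> Y \<Ztypecolon> Univ n"
begin

interpretation Partial_family n \<Gamma> "IsProp (Var 0)" Y by (rule LiftTm_family[OF Y])

lemma LiftTm_defined: "\<Gamma> \<turnstile> v \<Ztypecolon> LiftTm n Y \<Longrightarrow> \<Gamma> \<turnstile> Fst v \<Ztypecolon> Univ n"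
  and LiftTm_witness: "\<Gamma> \<turnstile> v \<Ztypecolon> LiftTm n Y \<Longrightarrow> \<Gamma> \<turnstile> Fst (Snd v) \<Ztypecolon> IsProp (Fst v)"
  and LiftTm_val: "\<Gamma> \<turnstile> v \<Ztypecolon> LiftTm n Y \<Longrightarrow> \<Gamma> \<turnstile> Snd (Snd v) \<Ztypecolon> Pi (Fst v) (lift 0 Y)"
  using ty_defined[of v] ty_witness[of v] ty_val[of v] by (simp_all add: LiftTm_def)

lemma ty_LiftTm_pair:
  "\<Gamma> \<turnstile> P \<Ztypecolon> Univ n \<Longrightarrow> \<Gamma> \<turnstile> h \<Ztypecolon> IsProp P \<Longrightarrow> \<Gamma> \<turnstile> v \<Ztypecolon> Pi P (lift 0 Y) \<Longrightarrow> \<Gamma> \<turnstile> Pr P (Pr h v) \<Ztypecolon> LiftTm n Y"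
  using ty_Partial_pair[of P h v] by (simp add: LiftTm_def)

lemma LiftTm_defined_beta:
  "\<Gamma> \<turnstile> P \<Ztypecolon> Univ n \<Longrightarrow> \<Gamma> \<turnstile> h \<Ztypecolon> IsProp P \<Longrightarrow> \<Gamma> \<turnstile> v \<Ztypecolon> Pi P (lift 0 Y) \<Longrightarrow> \<Gamma> \<turnstile> Fst (Pr P (Pr h v)) \<simeq> P
      \<Ztypecolon> Univ n"
  using defined_beta[of P h v] by simp

end

lemma eq_defined: "\<Gamma> \<turnstile> u \<simeq> v \<Ztypecolon> LiftTm n Y \<Longrightarrow> \<Gamma> \<turnstile> Fst u \<simeq> Fst v \<Ztypecolon> Univ n"
  unfolding LiftTm_def Partial_def by (rule eq_fst)

locale kleisli_data =
  fixes n \<Gamma> X Y g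
  assumes X: "\<Gamma> \<turnstile> X \<Ztypecolon> Univ n" and Y: "\<Gamma> \<turnstile> Y \<Ztypecolon> Univ n" and g: "\<Gamma> \<turnstile> g \<Ztypecolon> Pi X (lift 0 (LiftTm n Y))"
begin

lemma weaken:
  assumes "\<Gamma> \<turnstile> B \<Ztypecolon> Univ i"
  shows "kleisli_data n (B # \<Gamma>) (lift 0 X) (lift 0 Y) (lift 0 g)"
  using wk_ty[OF assms X] wk_ty[OF assms Y] wk[OF assms g] by unfold_locales simp_all

context
  fixes u assumes u: "\<Gamma> \<turnstile> u \<Ztypecolon> LiftTm n X"
begin

lemma ty_g_val: "\<Gamma> \<turnstile> p \<Ztypecolon> Fst u \<Longrightarrow> \<Gamma> \<turnstile> App g (App (Snd (Snd u)) p) \<Ztypecolon> LiftTm n Y"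
  by (rule app_arrow[OF g app_arrow[OF LiftTm_val[OF X u]]])

end

lemma ty_kl_family:
  assumes u: "\<Gamma> \<turnstile> u \<Ztypecolon> LiftTm n X"
  shows "Fst u # \<Gamma> \<turnstile> Fst (App (lift 0 g) (App (Snd (Snd (lift 0 u))) (Var 0))) \<Ztypecolon> Univ n"
proof -
  note P = LiftTm_defined[OF X u]
  interpret P: kleisli_data n "Fst u # \<Gamma>" "lift 0 X" "lift 0 Y" "lift 0 g" by (rule weaken[OF P])
  show ?thesis
    using LiftTm_defined[OF P.Y P.ty_g_val[of "lift 0 u" "Var 0"]] wk[OF P u] var0[OF P] by simp
qed

lemma ty_kl_defined: "\<Gamma> \<turnstile> u \<Ztypecolon> LiftTm n X \<Longrightarrow> \<Gamma> \<turnstile> kl_defined g u \<Ztypecolon> Univ n"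
  using ty_sig[OF LiftTm_defined[OF X] ty_kl_family] by (simp add: kl_defined_def)

lemma ty_K_path:
  assumes u: "\<Gamma> \<turnstile> u \<Ztypecolon> LiftTm n X" and v: "\<Gamma> \<turnstile> v \<Ztypecolon> kl_defined g u" and w: "\<Gamma> \<turnstile> w \<Ztypecolon> kl_defined g u"
  shows "\<Gamma> \<turnstile> sigma_path n (Fst u) (Fst (App (lift 0 g) (App (Snd (Snd (lift 0 u))) (Var 0))))
      (Fst (Snd (App g (App (Snd (Snd u)) (Fst v))))) (App (App (Fst (Snd u)) (Fst v)) (Fst w)) v w
      \<Ztypecolon> Eq (kl_defined g u) v w"
proof -
  note fv = ty_fst[OF v[unfolded kl_defined_def]] note fw = ty_fst[OF w[unfolded kl_defined_def]]
  from ty_sigma_path[OF LiftTm_defined[OF X u] ty_kl_family[OF u] v[unfolded kl_defined_def]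
      w[unfolded kl_defined_def]
      _ app_IsProp[OF LiftTm_witness[OF X u] fv fw]] LiftTm_witness[OF Y ty_g_val[OF u fv]]
  show ?thesis by (simp add: kl_defined_def)
qed

lemma ty_kl_witness:
  assumes u: "\<Gamma> \<turnstile> u \<Ztypecolon> LiftTm n X"
  shows "\<Gamma> \<turnstile> kl_witness n g u \<Ztypecolon> IsProp (kl_defined g u)"
proof -
  note S = ty_kl_defined[OF u]
  note S1 = wk_ty[OF S S]
  interpret S: kleisli_data n "kl_defined g u # \<Gamma>" "lift 0 X" "lift 0 Y" "lift 0 g"
      by (rule weaken[OF S])
  interpret S1: kleisli_data n "lift 0 (kl_defined g u) # kl_defined g u # \<Gamma>" "lift 0 (lift 0 X)"
      "lift 0 (lift 0 Y)" "lift 0 (lift 0 g)"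
    by (rule S.weaken[OF S1])
  from ty_lam[OF ty_lam[OF S1.ty_K_path[of "lift 0 (lift 0 u)" "Var (Suc 0)" "Var 0"]]]
    wk[OF S1 wk[OF S u]] wk[OF S1 var0[OF S]] var0[OF S1]
  show ?thesis by (simp add: kl_witness_def IsProp_def)
qed

lemma ty_kl_val:
  assumes u: "\<Gamma> \<turnstile> u \<Ztypecolon> LiftTm n X"
  shows "\<Gamma> \<turnstile> kl_val g u \<Ztypecolon> Pi (kl_defined g u) (lift 0 Y)"
proof -
  note S = ty_kl_defined[OF u]
  interpret S: kleisli_data n "kl_defined g u # \<Gamma>" "lift 0 X" "lift 0 Y" "lift 0 g"
      by (rule weaken[OF S])
  have u1: "kl_defined g u # \<Gamma> \<turnstile> lift 0 u \<Ztypecolon> LiftTm n (lift 0 X)"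
    using wk[OF S u] by simp
  have w: "kl_defined g u # \<Gamma> \<turnstile> Var 0 \<Ztypecolon> kl_defined (lift 0 g) (lift 0 u)"
    using var0[OF S] by simp
  \<comment> \<open>The instance unfolds the type while the context entry stays folded.\<close>
  note w = w[unfolded kl_defined_def[of "lift 0 g"]]
  from ty_lam[OF app_arrow[OF LiftTm_val[OF S.Y S.ty_g_val[OF u1 ty_fst[OF w]]]]] ty_snd[OF w]
  show ?thesis by (simp add: kl_val_def)
qed

lemma ty_K_pair: "\<Gamma> \<turnstile> u \<Ztypecolon> LiftTm n X \<Longrightarrow>
    \<Gamma> \<turnstile> Pr (kl_defined g u) (Pr (kl_witness n g u) (kl_val g u)) \<Ztypecolon> LiftTm n Y"
  by (rule ty_LiftTm_pair[OF Y ty_kl_defined ty_kl_witness ty_kl_val])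

lemma Kleisli:
  shows ty_Kleisli: "\<Gamma> \<turnstile> Kleisli n X g \<Ztypecolon> Pi (LiftTm n X) (lift 0 (LiftTm n Y))"
    and Kleisli_beta: "\<Gamma> \<turnstile> u \<Ztypecolon> LiftTm n X \<Longrightarrow> \<Gamma> \<turnstile> App (Kleisli n X g) u
        \<simeq> Pr (kl_defined g u) (Pr (kl_witness n g u) (kl_val g u)) \<Ztypecolon> LiftTm n Y"
proof -
  note L = ty_LiftTm[OF X]
  interpret L: kleisli_data n "LiftTm n X # \<Gamma>" "lift 0 X" "lift 0 Y" "lift 0 g"
      by (rule weaken[OF L])
  note b = L.ty_K_pair[OF var0[OF L, simplified]]
  from ty_lam[OF b] show "\<Gamma> \<turnstile> Kleisli n X g \<Ztypecolon> Pi (LiftTm n X) (lift 0 (LiftTm n Y))"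
    by (simp add: Kleisli_def)
  show "\<Gamma> \<turnstile> App (Kleisli n X g) u \<simeq> Pr (kl_defined g u) (Pr (kl_witness n g u) (kl_val g u))
      \<Ztypecolon> LiftTm n Y" if "\<Gamma> \<turnstile> u \<Ztypecolon> LiftTm n X"
    using pi_beta[OF b that] by (simp add: Kleisli_def)
qed

end

section \<open>The unit type and the unit of the monad\<close>

abbreviation One :: "nat \<Rightarrow> tm" where "One n \<equiv> Con (UnitT n)"

lemma ty_One: "ctx \<Gamma> \<Longrightarrow> \<Gamma> \<turnstile> One n \<Ztypecolon> Univ n"
  using ty_con[of \<Gamma> "UnitT n"] by (simp add: sterm_defs)

lemma ty_Star: "ctx \<Gamma> \<Longrightarrow> \<Gamma> \<turnstile> Con (Star n) \<Ztypecolon> One n"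
  using ty_con[of \<Gamma> "Star n"] by (simp add: sterm_defs)

text \<open>As for identity types, the constant expects the motive as a function; beta conversion
  allows an open type \<open>M\<close> instead.\<close>

lemma unit_ind:
  assumes M: "One i # \<Gamma> \<turnstile> M \<Ztypecolon> Univ j" and c: "\<Gamma> \<turnstile> c \<Ztypecolon> subst 0 (Con (Star i)) M"
  shows "\<Gamma> \<turnstile> apps (Con (UnitInd i j)) [Lam (One i) M, c] \<Ztypecolon> Pi (One i) M"
proof -
  have ctx: "ctx \<Gamma>" using typing_ctx(2)[OF M] by (rule ctx_tail)
  note One = ty_One[OF ctx, of i]
  define C where "C = Lam (One i) M"
  have C: "\<Gamma> \<turnstile> C \<Ztypecolon> Pi (One i) (Univ j)"
    unfolding C_def by (rule ty_lam[OF M])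
  have "\<Gamma> \<turnstile> App C (Con (Star i)) \<simeq> subst 0 (Con (Star i)) M \<Ztypecolon> Univ j"
    using pi_beta[OF M ty_Star[OF ctx]] by (simp add: C_def)
  note c = ty_conv[OF c eq_sym[OF this]]
  have "One i # \<Gamma> \<turnstile> App (lift 0 C) (Var 0) \<simeq> M \<Ztypecolon> Univ j"
    using pi_beta[OF wk1[OF One M] var0[OF One]] by (simp add: C_def)
  note e = eq_pi[OF eq_refl[OF One] this]
  have "\<Gamma> \<turnstile> Con (UnitInd i j) \<Ztypecolon> con_type (UnitInd i j) 0"
    by (rule ty_con[OF ctx])
  note 1 = ty_app[OF this[simplified sterm_defs con_type.simps, simplified] C, simplified]
  note 2 = ty_app[OF 1 c, simplified]
  from ty_conv[OF 2 e] show ?thesis by (simp add: C_def)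
qed

definition UnitProp :: "nat \<Rightarrow> tm" where
  "UnitProp n = apps (Con (UnitInd n n)) [Lam (One n) (Pi (One n) (Eq (One n) (Var (Suc 0))
      (Var 0))),
    apps (Con (UnitInd n n)) [Lam (One n) (Eq (One n) (Con (Star n)) (Var 0)), Refl
        (Con (Star n))]]"

lemma lift_UnitProp [simp]: "lift k (UnitProp n) = UnitProp n"
    and subst_UnitProp [simp]: "subst k s (UnitProp n) = UnitProp n"
  by (simp_all add: UnitProp_def)

lemma ty_UnitProp:
  assumes "ctx \<Gamma>"
  shows "\<Gamma> \<turnstile> UnitProp n \<Ztypecolon> IsProp (One n)"
proof -
  note O = ty_One[OF assms, of n]
  note c1 = ctx_ext[OF O]
  note O1 = ty_One[OF c1, of n]
  note c2 = ctx_ext[OF O1]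
  have "One n # \<Gamma> \<turnstile> Eq (One n) (Con (Star n)) (Var 0) \<Ztypecolon> Univ n"
    using ty_eq[OF O1 ty_Star[OF c1]] var0[OF O] by simp
  note 1 = unit_ind[OF this, simplified, OF ty_refl[OF ty_Star[OF assms]]]
  have "One n # One n # \<Gamma> \<turnstile> Eq (One n) (Var (Suc 0)) (Var 0) \<Ztypecolon> Univ n"
    using ty_eq[OF ty_One[OF c2]] wk[OF O1 var0[OF O]] var0[OF O1] by simp
  from unit_ind[OF ty_pi[OF O1 this, simplified]] 1 show ?thesis
    by (simp add: UnitProp_def IsProp_def)
qed

definition Eta :: "nat \<Rightarrow> tm \<Rightarrow> tm" where
  "Eta n Y = Lam Y (Pr (One n) (Pr (UnitProp n) (Lam (One n) (Var (Suc 0)))))"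

lemma lift_Eta [simp]: "lift k (Eta n Y) = Eta n (lift k Y)"
  by (simp add: Eta_def)

lemma subst_Eta [simp]: "subst k s (Eta n Y) = Eta n (subst k s Y)"
  by (simp add: Eta_def)

lemma Eta:
  assumes Y: "\<Gamma> \<turnstile> Y \<Ztypecolon> Univ n"
  shows ty_Eta: "\<Gamma> \<turnstile> Eta n Y \<Ztypecolon> Pi Y (lift 0 (LiftTm n Y))"
    and Eta_beta: "\<Gamma> \<turnstile> y \<Ztypecolon> Y \<Longrightarrow> \<Gamma> \<turnstile> App (Eta n Y) y \<simeq> Pr (One n) (Pr (UnitProp n) (Lam (One n)
        (lift 0 y))) \<Ztypecolon> LiftTm n Y"
proof -
  note c = ctx_ext[OF Y]
  note O = ty_One[OF c, of n]
  have "Y # \<Gamma> \<turnstile> Lam (One n) (Var (Suc 0)) \<Ztypecolon> Pi (One n) (lift 0 (lift 0 Y))"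
    using ty_lam[OF wk[OF O var0[OF Y], simplified]] .
  note b = ty_LiftTm_pair[OF wk_ty[OF Y Y] O ty_UnitProp[OF c] this]
  from ty_lam[OF b] show "\<Gamma> \<turnstile> Eta n Y \<Ztypecolon> Pi Y (lift 0 (LiftTm n Y))"
    by (simp add: Eta_def)
  show "\<Gamma> \<turnstile> App (Eta n Y) y \<simeq> Pr (One n) (Pr (UnitProp n) (Lam (One n) (lift 0 y))) \<Ztypecolon> LiftTm n Y"
      if "\<Gamma> \<turnstile> y \<Ztypecolon> Y"
    using pi_beta[OF b that] by (simp add: Eta_def)
qed

section \<open>Factorisations\<close>

text \<open>Both halves of \<open>is_submonad\<close> are products of types of this form, with
  \<open>F\<close> the unit in one and \<open>KleisliIncl\<close> in the other.\<close>

definition Factor :: "nat \<Rightarrow> tm \<Rightarrow> tm \<Rightarrow> tm \<Rightarrow> tm \<Rightarrow> tm \<Rightarrow> tm" where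
  "Factor n d s A Y F = Sig (Pi A (lift 0 (LiftdTm n d Y)))
    (Eq (lift 0 (Pi A (lift 0 (LiftTm n Y)))) (Comp (lift 0 A) (lift 0 (Incl n d s Y)) (Var 0))
        (lift 0 F))"

lemma lift_Factor [simp]:
  "lift k (Factor n d s A Y F) = Factor n (lift k d) (lift k s) (lift k A) (lift k Y) (lift k F)"
  by (simp add: Factor_def)

lemma subst_Factor [simp]:
  "subst k t (Factor n d s A Y F) = Factor n (subst k t d) (subst k t s) (subst k t A) (subst k t
      Y) (subst k t F)"
  by (simp add: Factor_def)

text \<open>The right-hand side of the second submonad condition: embed, then apply the Kleisli
  extension of the embedded \<open>f\<close>.\<close>

definition KleisliIncl :: "nat \<Rightarrow> tm \<Rightarrow> tm \<Rightarrow> tm \<Rightarrow> tm \<Rightarrow> tm \<Rightarrow> tm" where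
  "KleisliIncl n d s X Y f = Comp (LiftdTm n d X) (Kleisli n X (Comp X (Incl n d s Y) f)) (Incl n
      d s X)"

lemma lift_KleisliIncl [simp]:
  "lift k (KleisliIncl n d s X Y f) = KleisliIncl n (lift k d) (lift k s) (lift k X) (lift k Y)
      (lift k f)"
  by (simp add: KleisliIncl_def)

lemma subst_KleisliIncl [simp]:
  "subst k t (KleisliIncl n d s X Y f) = KleisliIncl n (subst k t d) (subst k t s) (subst k t X)
      (subst k t Y) (subst k t f)"
  by (simp add: KleisliIncl_def)

context prop_set
begin

context
  fixes A i Y F
  assumes A: "\<Gamma> \<turnstile> A \<Ztypecolon> Univ i" and Y: "\<Gamma> \<turnstile> Y \<Ztypecolon> Univ n" and F: "\<Gamma> \<turnstile> F \<Ztypecolon> Pi A (lift 0 (LiftTm n Y))"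
begin

lemma ty_factor_eq:
  "Pi A (lift 0 (LiftdTm n d Y)) # \<Gamma> \<turnstile>
    Eq (lift 0 (Pi A (lift 0 (LiftTm n Y)))) (Comp (lift 0 A) (lift 0 (Incl n d s Y)) (Var 0))
        (lift 0 F) \<Ztypecolon> Univ (max i (Suc n))"
  and ty_factor: "\<Gamma> \<turnstile> Pi A (lift 0 (LiftdTm n d Y)) \<Ztypecolon> Univ (max i (Suc n))"
proof -
  have E: "\<Gamma> \<turnstile> Pi A (lift 0 (LiftdTm n d Y)) \<Ztypecolon> Univ (max i (Suc n))"
    by (rule ty_pi[OF A wk_ty[OF A ty_LiftdTm[OF Y]]])
  then show "\<Gamma> \<turnstile> Pi A (lift 0 (LiftdTm n d Y)) \<Ztypecolon> Univ (max i (Suc n))" .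
  note T = ty_pi[OF A wk_ty[OF A ty_LiftTm[OF Y]]]
  interpret E: prop_set n "Pi A (lift 0 (LiftdTm n d Y)) # \<Gamma>" "lift 0 d" "lift 0 s"
      by (rule weaken[OF E])
  have "Pi A (lift 0 (LiftdTm n d Y)) # \<Gamma> \<turnstile> Comp (lift 0 A) (lift 0 (Incl n d s Y)) (Var 0)
      \<Ztypecolon> Pi (lift 0 A) (lift 0 (lift 0 (LiftTm n Y)))"
    using ty_Comp[OF wk_ty[OF E A] _ E.ty_Incl[OF wk_ty[OF E Y]], of "Var 0"] var0[OF E] by simp
  then show "Pi A (lift 0 (LiftdTm n d Y)) # \<Gamma> \<turnstile>
    Eq (lift 0 (Pi A (lift 0 (LiftTm n Y)))) (Comp (lift 0 A) (lift 0 (Incl n d s Y)) (Var 0))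
        (lift 0 F) \<Ztypecolon> Univ (max i (Suc n))"
    using ty_eq[OF wk_ty[OF E T] _ wk[OF E F]] by simp
qed

lemma ty_Factor: "\<Gamma> \<turnstile> Factor n d s A Y F \<Ztypecolon> Univ (max i (Suc n))"
  using ty_sig[OF ty_factor ty_factor_eq] by (simp add: Factor_def)

lemma Factor_intro:
  assumes P: "A # \<Gamma> \<turnstile> P \<Ztypecolon> Univ n" and h: "A # \<Gamma> \<turnstile> h \<Ztypecolon> IsProp P"
    and v: "A # \<Gamma> \<turnstile> v \<Ztypecolon> Pi P (lift 0 (lift 0 Y))"
    and F_eq: "A # \<Gamma> \<turnstile> App (lift 0 F) (Var 0) \<simeq> Pr P (Pr h v) \<Ztypecolon> lift 0 (LiftTm n Y)"
    and k: "inhab (A # \<Gamma>) (App (lift 0 d) P)"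
  shows "inhab \<Gamma> (Factor n d s A Y F)"
proof -
  from factor_intro[OF A Y F P h v F_eq k] obtain e q where
    e: "\<Gamma> \<turnstile> e \<Ztypecolon> Pi A (lift 0 (LiftdTm n d Y))"
    and q: "\<Gamma> \<turnstile> q \<Ztypecolon> Eq (Pi A (lift 0 (LiftTm n Y))) (Comp A (Incl n d s Y) e) F"
    by (auto simp: inhab_def)
  from ty_pair[OF ty_factor_eq e, of q] q show ?thesis by (auto simp: Factor_def intro: inhabI)
qed

lemma Factor_elim:
  assumes t: "inhab \<Gamma> (Factor n d s A Y F)" and a: "\<Gamma> \<turnstile> a \<Ztypecolon> A"
  shows "inhab \<Gamma> (App d (Fst (App F a)))"
proof -
  from t obtain t where t: "\<Gamma> \<turnstile> t \<Ztypecolon> Factor n d s A Y F" by (auto simp: inhab_def)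
  note e = ty_fst[OF t[unfolded Factor_def]]
  from factor_elim[OF A Y F e inhabI a] ty_snd[OF t[unfolded Factor_def]] show ?thesis by simp
qed

end

lemma Factor_Eta:
  assumes Y: "\<Gamma> \<turnstile> Y \<Ztypecolon> Univ n" and one: "inhab \<Gamma> (App d (One n))"
  shows "inhab \<Gamma> (Factor n d s Y Y (Eta n Y))"
proof (rule Factor_intro[OF Y Y ty_Eta[OF Y]])
  note c = ctx_ext[OF Y]
  show O: "Y # \<Gamma> \<turnstile> One n \<Ztypecolon> Univ n" by (rule ty_One[OF c])
  show "Y # \<Gamma> \<turnstile> UnitProp n \<Ztypecolon> IsProp (One n)" by (rule ty_UnitProp[OF c])
  show "Y # \<Gamma> \<turnstile> Lam (One n) (Var (Suc 0)) \<Ztypecolon> Pi (One n) (lift 0 (lift 0 Y))"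
    using ty_lam[OF wk[OF O var0[OF Y], simplified]] .
  show "Y # \<Gamma> \<turnstile> App (lift 0 (Eta n Y)) (Var 0) \<simeq> Pr (One n) (Pr (UnitProp n) (Lam (One n)
      (Var (Suc 0)))) \<Ztypecolon> lift 0 (LiftTm n Y)"
    using Eta_beta[OF wk_ty[OF Y Y] var0[OF Y]] by simp
  show "inhab (Y # \<Gamma>) (App (lift 0 d) (One n))"
    using one wk[OF Y] by (force simp: inhab_def)
qed

text \<open>At Y = 1 there is a closed point at which to evaluate the factorisation, and the domain
  of the unit there is judgementally 1.\<close>

lemma d_One:
  assumes "inhab \<Gamma> (Factor n d s (One n) (One n) (Eta n (One n)))"
  shows "inhab \<Gamma> (App d (One n))"
proof -
  have c: "ctx \<Gamma>" by (rule typing_ctx(2)[OF d])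
  note O = ty_One[OF c, of n] and star = ty_Star[OF c, of n]
  have v: "\<Gamma> \<turnstile> Lam (One n) (Con (Star n)) \<Ztypecolon> Pi (One n) (lift 0 (One n))"
    using ty_lam[OF ty_Star[OF ctx_ext[OF O]]] by simp
  have "\<Gamma> \<turnstile> Fst (App (Eta n (One n)) (Con (Star n)))
      \<simeq> Fst (Pr (One n) (Pr (UnitProp n) (Lam (One n) (Con (Star n))))) \<Ztypecolon> Univ n"
    using eq_defined[OF Eta_beta[OF O star]] by simp
  also note LiftTm_defined_beta[OF O O ty_UnitProp[OF c] v]
  finally show ?thesis
    by (rule inhab_conv[OF Factor_elim[OF O O ty_Eta[OF O] assms star] eq_d])
qed

section \<open>Kleisli extensions along the embedding and closure under sums\<close>

context
  fixes X Y f
  assumes X: "\<Gamma> \<turnstile> X \<Ztypecolon> Univ n" and Y: "\<Gamma> \<turnstile> Y \<Ztypecolon> Univ n" and f: "\<Gamma> \<turnstile> f \<Ztypecolon> Pi X (lift 0 (LiftdTm n d Y))"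
begin

lemma kleisli: "kleisli_data n \<Gamma> X Y (Comp X (Incl n d s Y) f)"
  using X Y ty_Comp[OF X f ty_Incl[OF Y]] by unfold_locales

interpretation K: kleisli_data n \<Gamma> X Y "Comp X (Incl n d s Y) f" by (rule kleisli)

lemma ty_KleisliIncl: "\<Gamma> \<turnstile> KleisliIncl n d s X Y f \<Ztypecolon> Pi (LiftdTm n d X) (lift 0 (LiftTm n Y))"
  unfolding KleisliIncl_def by (rule ty_Comp[OF ty_LiftdTm[OF X] ty_Incl[OF X] K.ty_Kleisli])

lemma KleisliIncl_beta:
  assumes u: "\<Gamma> \<turnstile> u \<Ztypecolon> LiftdTm n d X"
  defines "g \<equiv> Comp X (Incl n d s Y) f" and "w \<equiv> App (Incl n d s X) u"
  shows "\<Gamma> \<turnstile> App (KleisliIncl n d s X Y f) u \<simeq> Pr (kl_defined g w) (Pr (kl_witness n g w) (kl_val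
      g w)) \<Ztypecolon> LiftTm n Y"
  unfolding KleisliIncl_def g_def w_def
  by (rule eq_trans[OF Comp_beta[OF ty_LiftdTm[OF X] ty_Incl[OF X] K.ty_Kleisli u] K.Kleisli_beta])
    (rule app_arrow[OF ty_Incl[OF X] u])

lemma g_defined:
  assumes "\<Gamma> \<turnstile> x \<Ztypecolon> X"
  shows "\<Gamma> \<turnstile> Fst (App (Comp X (Incl n d s Y) f) x) \<simeq> Fst (App f x) \<Ztypecolon> Univ n"
  by (rule eq_trans[OF eq_defined[OF Comp_beta[OF X f ty_Incl[OF Y] assms]]
        Incl_defined[OF Y app_arrow[OF f assms]]])

end

text \<open>\<open>u\<close> carries the witness for its own domain, and each value of
  \<open>f\<close> the witness for a fibre. The embedding preserves domains judgementally, so both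
  witnesses carry over, and \<open>d_sigma\<close> combines them.\<close>

lemma d_kl_defined:
  assumes X: "\<Gamma> \<turnstile> X \<Ztypecolon> Univ n" and Y: "\<Gamma> \<turnstile> Y \<Ztypecolon> Univ n" and f: "\<Gamma> \<turnstile> f \<Ztypecolon> Pi X (lift 0 (LiftdTm n d Y))"
    and u: "\<Gamma> \<turnstile> u \<Ztypecolon> LiftdTm n d X"
    and clo: "\<And>P Q. \<Gamma> \<turnstile> P \<Ztypecolon> Univ n \<Longrightarrow> \<Gamma> \<turnstile> Q \<Ztypecolon> Univ n \<Longrightarrow> inhab \<Gamma> (App d P) \<Longrightarrow>
      inhab (P # \<Gamma>) (lift 0 (App d Q)) \<Longrightarrow> inhab \<Gamma> (App d (Sig P (lift 0 Q)))"
  defines "g \<equiv> Comp X (Incl n d s Y) f" and "w \<equiv> App (Incl n d s X) u"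
  shows "inhab \<Gamma> (App d (kl_defined g w))"
proof -
  interpret K: kleisli_data n \<Gamma> X Y g unfolding g_def by (rule kleisli[OF X Y f])
  have w: "\<Gamma> \<turnstile> w \<Ztypecolon> LiftTm n X"
    unfolding w_def by (rule app_arrow[OF ty_Incl[OF X] u])
  note P = LiftTm_defined[OF X w]
  have "inhab \<Gamma> (App d (Fst w))"
    unfolding w_def by (rule inhab_conv[OF inhabI[OF LiftdTm_witness[OF X u]] eq_d[OF eq_sym[OF
        Incl_defined[OF X u]]]])
  moreover have "inhab (Fst w # \<Gamma>) (App (lift 0 d) (Fst (App (lift 0 g)
      (App (Snd (Snd (lift 0 w))) (Var 0)))))"
  proof -
    interpret P: prop_set n "Fst w # \<Gamma>" "lift 0 d" "lift 0 s" by (rule weaken[OF P])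
    note X1 = wk_ty[OF P X] and Y1 = wk_ty[OF P Y]
    have f1: "Fst w # \<Gamma> \<turnstile> lift 0 f \<Ztypecolon> Pi (lift 0 X) (lift 0 (LiftdTm n (lift 0 d) (lift 0 Y)))"
      using wk[OF P f] by simp
    have x: "Fst w # \<Gamma> \<turnstile> App (Snd (Snd (lift 0 w))) (Var 0) \<Ztypecolon> lift 0 X"
      using app_arrow[OF LiftTm_val[OF X1, of "lift 0 w"]] wk[OF P w] var0[OF P] by simp
    from inhab_conv[OF inhabI[OF P.LiftdTm_witness[OF Y1 app_arrow[OF f1 x]]] P.eq_d[OF eq_sym[OF
        P.g_defined[OF X1 Y1 f1 x]]]]
    show ?thesis by (simp add: g_def)
  qed
  ultimately show ?thesis
    using d_sigma[OF clo P K.ty_kl_family[OF w]] inhabI[OF K.ty_kl_witness[OF w]]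
        by (simp add: kl_defined_def)
qed

text \<open>The pointwise criterion is checked at a generic element of \<open>LiftdTm n d X\<close>,
  which is why closure is assumed in the context extended by that variable.\<close>

lemma Factor_KleisliIncl:
  assumes X: "\<Gamma> \<turnstile> X \<Ztypecolon> Univ n" and Y: "\<Gamma> \<turnstile> Y \<Ztypecolon> Univ n" and f: "\<Gamma> \<turnstile> f \<Ztypecolon> Pi X (lift 0 (LiftdTm n d Y))"
    and clo: "\<And>P Q. LiftdTm n d X # \<Gamma> \<turnstile> P \<Ztypecolon> Univ n \<Longrightarrow> LiftdTm n d X # \<Gamma> \<turnstile> Q \<Ztypecolon> Univ n \<Longrightarrow>
      inhab (LiftdTm n d X # \<Gamma>) (App (lift 0 d) P) \<Longrightarrow>
        inhab (P # LiftdTm n d X # \<Gamma>) (lift 0 (App (lift 0 d) Q)) \<Longrightarrow>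
      inhab (LiftdTm n d X # \<Gamma>) (App (lift 0 d) (Sig P (lift 0 Q)))"
  shows "inhab \<Gamma> (Factor n d s (LiftdTm n d X) Y (KleisliIncl n d s X Y f))"
proof -
  note L = ty_LiftdTm[OF X]
  interpret L: prop_set n "LiftdTm n d X # \<Gamma>" "lift 0 d" "lift 0 s" by (rule weaken[OF L])
  note X1 = wk_ty[OF L X] and Y1 = wk_ty[OF L Y]
  have f1: "LiftdTm n d X # \<Gamma> \<turnstile> lift 0 f \<Ztypecolon> Pi (lift 0 X) (lift 0 (LiftdTm n (lift 0 d) (lift 0 Y)))"
    using wk[OF L f] by simp
  have u: "LiftdTm n d X # \<Gamma> \<turnstile> Var 0 \<Ztypecolon> LiftdTm n (lift 0 d) (lift 0 X)"
    using var0[OF L] by simp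
  interpret K: kleisli_data n "LiftdTm n d X # \<Gamma>" "lift 0 X" "lift 0 Y"
      "Comp (lift 0 X) (Incl n (lift 0 d) (lift 0 s) (lift 0 Y)) (lift 0 f)"
    by (rule L.kleisli[OF X1 Y1 f1])
  note w = app_arrow[OF L.ty_Incl[OF X1] u]
  show ?thesis
    using Factor_intro[OF L Y ty_KleisliIncl[OF X Y f] K.ty_kl_defined[OF w] K.ty_kl_witness[OF w]
        K.ty_kl_val[OF w] _ L.d_kl_defined[OF X1 Y1 f1 u clo]]
      L.KleisliIncl_beta[OF X1 Y1 f1 u]
    by simp
qed

text \<open>Factorisations are used at X = P and Y = Q. The identity maps on \<open>P\<close> and
  \<open>Q\<close> serve as value maps, so no elements have to be chosen and the proofs of d P and d
  Q are the remaining data.\<close>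

lemma d_closed:
  assumes P: "\<Gamma> \<turnstile> P \<Ztypecolon> Univ n" and Q: "\<Gamma> \<turnstile> Q \<Ztypecolon> Univ n"
    and dP: "inhab \<Gamma> (App d P)" and dQ: "inhab (P # \<Gamma>) (lift 0 (App d Q))"
    and Factor: "\<And>f. \<Gamma> \<turnstile> f \<Ztypecolon> Pi P (lift 0 (LiftdTm n d Q)) \<Longrightarrow>
        inhab \<Gamma> (Factor n d s (LiftdTm n d P) Q (KleisliIncl n d s P Q f))"
  shows "inhab \<Gamma> (App d (Sig P (lift 0 Q)))"
proof -
  from dP dQ obtain a b where a: "\<Gamma> \<turnstile> a \<Ztypecolon> App d P" and b: "P # \<Gamma> \<turnstile> b \<Ztypecolon> App (lift 0 d) (lift 0 Q)"
    by (auto simp: inhab_def)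
  interpret P: prop_set n "P # \<Gamma>" "lift 0 d" "lift 0 s" by (rule weaken[OF P])
  \<comment> \<open>\<open>u\<close> is (P, a, id), and \<open>f\<close> sends p to (Q, b p, id).
    The Kleisli extension therefore has domain P \<times> Q at \<open>u\<close>.\<close>
  define u where "u = Pr P (Pr a (Lam P (Var 0)))"
  define y where "y = Pr (lift 0 Q) (Pr b (Lam (lift 0 Q) (Var 0)))"
  define f where "f = Lam P y"
  note Q1 = wk_ty[OF P Q]
  note id = ty_lam[OF var0]
  have u: "\<Gamma> \<turnstile> u \<Ztypecolon> LiftdTm n d P"
    unfolding u_def by (rule ty_LiftdTm_pair[OF P P a id[OF P]])
  have y: "P # \<Gamma> \<turnstile> y \<Ztypecolon> LiftdTm n (lift 0 d) (lift 0 Q)"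
    unfolding y_def by (rule P.ty_LiftdTm_pair[OF Q1 Q1 b id[OF Q1]])
  have f: "\<Gamma> \<turnstile> f \<Ztypecolon> Pi P (lift 0 (LiftdTm n d Q))"
    using ty_lam[OF y] by (simp add: f_def)
  define g where "g = Comp P (Incl n d s Q) f"
  define w where "w = App (Incl n d s P) u"
  interpret K: kleisli_data n \<Gamma> P Q g unfolding g_def by (rule kleisli[OF P Q f])
  have w: "\<Gamma> \<turnstile> w \<Ztypecolon> LiftTm n P"
    unfolding w_def by (rule app_arrow[OF ty_Incl[OF P] u])
  note D = LiftTm_defined[OF P w]
  have D_eq: "\<Gamma> \<turnstile> Fst w \<simeq> P \<Ztypecolon> Univ n"
    unfolding w_def
    by (rule eq_trans[OF Incl_defined[OF P u]]) (unfold u_def, rule LiftdTm_defined_beta[OF P P a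
        id[OF P]])
  \<comment> \<open>The variable has type \<open>Fst w\<close> rather than \<open>P\<close>, because
    the congruence rule for sums compares fibres over the left-hand domain.\<close>
  have "Fst w # \<Gamma> \<turnstile> Fst (App (lift 0 g) (App (Snd (Snd (lift 0 w))) (Var 0))) \<simeq> lift 0 Q \<Ztypecolon> Univ n"
  proof -
    interpret D: prop_set n "Fst w # \<Gamma>" "lift 0 d" "lift 0 s" by (rule weaken[OF D])
    note P1 = wk_ty[OF D P] and Q1 = wk_ty[OF D Q]
    have f1: "Fst w # \<Gamma> \<turnstile> lift 0 f \<Ztypecolon> Pi (lift 0 P) (lift 0 (LiftdTm n (lift 0 d) (lift 0 Q)))"
      using wk[OF D f] by simp
    define x where "x = App (Snd (Snd (lift 0 w))) (Var 0)"
    have x: "Fst w # \<Gamma> \<turnstile> x \<Ztypecolon> lift 0 P"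
      using app_arrow[OF LiftTm_val[OF P1, of "lift 0 w"]] wk[OF D w] var0[OF D]
        by (simp add: x_def)
    have b1: "Fst w # \<Gamma> \<turnstile> subst 0 x (lift (Suc 0) b) \<Ztypecolon> App (lift 0 d) (lift 0 Q)"
      using substitution[OF x wk1[OF D b]] by simp
    have "Fst w # \<Gamma> \<turnstile> App (lift 0 f) x \<simeq> Pr (lift 0 Q) (Pr (subst 0 x (lift (Suc 0) b))
        (Lam (lift 0 Q) (Var 0)))
        \<Ztypecolon> LiftdTm n (lift 0 d) (lift 0 Q)"
      using pi_beta[OF wk1[OF D y] x] by (simp add: f_def y_def)
    from eq_trans[OF eq_trans[OF D.g_defined[OF P1 Q1 f1 x] eq_fst[OF this[unfolded LiftdTm_def
        Partial_def]]]
        D.LiftdTm_defined_beta[OF Q1 Q1 b1 id[OF Q1]]]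
    show ?thesis by (simp add: g_def x_def)
  qed
  with D_eq have "\<Gamma> \<turnstile> kl_defined g w \<simeq> Sig P (lift 0 Q) \<Ztypecolon> Univ n"
    unfolding kl_defined_def using eq_sig by fastforce
  moreover have "\<Gamma> \<turnstile> Fst (App (KleisliIncl n d s P Q f) u) \<simeq> kl_defined g w \<Ztypecolon> Univ n"
    by (rule eq_trans[OF eq_defined[OF KleisliIncl_beta[OF P Q f u, folded g_def w_def]]
          LiftTm_defined_beta[OF Q K.ty_kl_defined[OF w] K.ty_kl_witness[OF w] K.ty_kl_val[OF w]]])
  ultimately show ?thesis
    using inhab_conv[OF Factor_elim[OF ty_LiftdTm[OF P] Q ty_KleisliIncl[OF P Q f] Factor[OF f]
        u]] eq_d eq_trans by blast
qed

end

section \<open>Dominances and submonads\<close>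

definition SetOfProps :: "nat \<Rightarrow> tm \<Rightarrow> tm" where
  "SetOfProps n d = Sig (Pi (Univ n) (IsProp (App (lift 0 d) (Var 0))))
    (lift 0 (Pi (Univ n) (Pi (App (lift 0 d) (Var 0)) (IsProp (Var (Suc 0))))))"

text \<open>The two equal variables in the final \<open>Sig\<close> denote different things: the
  first is P, the second is Q seen from under the extra binder. Both uses of \<open>d4\<close> lie
  below four binders, inside the premise P \<rightarrow> d Q and after it.\<close>

definition SumClosed :: "nat \<Rightarrow> tm \<Rightarrow> tm" where
  "SumClosed n d = (let d2 = lift 0 (lift 0 d); d4 = lift 0 (lift 0 d2) in
    Pi (Univ n) (Pi (Univ n) (Pi (App d2 (Var (Suc 0)))
      (Pi (Pi (Var (Suc (Suc 0))) (App d4 (Var (Suc (Suc 0)))))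
        (App d4 (Sig (Var (Suc (Suc (Suc 0)))) (Var (Suc (Suc (Suc 0))))))))))"

definition Dominance :: "nat \<Rightarrow> tm \<Rightarrow> tm" where
  "Dominance n d = Sig (SetOfProps n d) (lift 0 (Sig (App d (One n)) (lift 0 (SumClosed n d))))"

definition UnitFactors :: "nat \<Rightarrow> tm \<Rightarrow> tm \<Rightarrow> tm" where
  "UnitFactors n d s = Pi (Univ n) (Factor n (lift 0 d) (lift 0 s) (Var 0) (Var 0) (Eta n (Var 0)))"

definition KleisliFactors :: "nat \<Rightarrow> tm \<Rightarrow> tm \<Rightarrow> tm" where
  "KleisliFactors n d s = (let d2 = lift 0 (lift 0 d); d3 = lift 0 d2; s3 = lift 0 (lift 0 (lift 0
      s)) in
    Pi (Univ n) (Pi (Univ n) (Pi (Pi (Var (Suc 0)) (lift 0 (LiftdTm n d2 (Var 0))))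
      (Factor n d3 s3 (LiftdTm n d3 (Var (Suc (Suc 0)))) (Var (Suc 0))
        (KleisliIncl n d3 s3 (Var (Suc (Suc 0))) (Var (Suc 0)) (Var 0))))))"

lemma lift_defs [simp]:
  "lift k (SetOfProps n d) = SetOfProps n (lift k d)"
  "lift k (SumClosed n d) = SumClosed n (lift k d)"
  "lift k (Dominance n d) = Dominance n (lift k d)"
  "lift k (UnitFactors n d s) = UnitFactors n (lift k d) (lift k s)"
  "lift k (KleisliFactors n d s) = KleisliFactors n (lift k d) (lift k s)"
  by (simp_all add: SetOfProps_def SumClosed_def Dominance_def UnitFactors_def KleisliFactors_def
      Let_def)

lemma subst_defs [simp]:
  "subst k t (SetOfProps n d) = SetOfProps n (subst k t d)"
  "subst k t (SumClosed n d) = SumClosed n (subst k t d)"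
  by (simp_all add: SetOfProps_def SumClosed_def Let_def)

text \<open>The pairing rule demands a well-formed family, which is why formation of the component
  types is established alongside their inhabitants.\<close>

lemma inhab_pair:
  assumes "\<Gamma> \<turnstile> B \<Ztypecolon> Univ j" "\<Gamma> \<turnstile> A \<Ztypecolon> Univ i" "inhab \<Gamma> A" "inhab \<Gamma> B"
  shows "inhab \<Gamma> (Sig A (lift 0 B))"
  using assms(3,4) ty_pair[OF wk_ty[OF assms(2,1)]] by (fastforce simp: inhab_def)

lemma inhab_fst: "inhab \<Gamma> (Sig A (lift 0 B)) \<Longrightarrow> inhab \<Gamma> A"
  by (auto simp: inhab_def intro: ty_fst)

lemma inhab_snd: "inhab \<Gamma> (Sig A (lift 0 B)) \<Longrightarrow> inhab \<Gamma> B"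
  unfolding inhab_def by (force dest: ty_snd)

lemma ty_SetOfProps:
  assumes d: "\<Gamma> \<turnstile> d \<Ztypecolon> Pi (Univ n) (Univ n)"
  shows "\<Gamma> \<turnstile> SetOfProps n d \<Ztypecolon> Univ (Suc n)"
proof -
  note ty_U = ty_univ[OF typing_ctx(2)[OF d], of n]
  note X = var0[OF ty_U, simplified]
  have dX: "Univ n # \<Gamma> \<turnstile> App (lift 0 d) (Var 0) \<Ztypecolon> Univ n"
    using ty_app[OF wk[OF ty_U d, simplified] X] by simp
  have 1: "\<Gamma> \<turnstile> Pi (Univ n) (IsProp (App (lift 0 d) (Var 0))) \<Ztypecolon> Univ (Suc n)"
    using ty_pi[OF ty_U ty_IsProp[OF dX]] by (simp add: max_def)
  have 2: "\<Gamma> \<turnstile> Pi (Univ n) (Pi (App (lift 0 d) (Var 0)) (IsProp (Var (Suc 0)))) \<Ztypecolon> Univ (Suc n)"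
    using ty_pi[OF ty_U ty_pi[OF dX ty_IsProp[OF wk_ty[OF dX X, simplified]]]]
        by (simp add: max_def)
  show "\<Gamma> \<turnstile> SetOfProps n d \<Ztypecolon> Univ (Suc n)"
    using ty_sig[OF 1 wk_ty[OF 1 2]] by (simp only: SetOfProps_def max.idem)
qed

context prop_set
begin

lemma SumClosed_elim:
  assumes c: "inhab \<Gamma> (SumClosed n d)" and P: "\<Gamma> \<turnstile> P \<Ztypecolon> Univ n" and Q: "\<Gamma> \<turnstile> Q \<Ztypecolon> Univ n"
    and dP: "inhab \<Gamma> (App d P)" and dQ: "inhab (P # \<Gamma>) (lift 0 (App d Q))"
  shows "inhab \<Gamma> (App d (Sig P (lift 0 Q)))"
proof -
  from c dP inhab_lam[OF dQ] obtain c a b where c: "\<Gamma> \<turnstile> c \<Ztypecolon> SumClosed n d"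
    and a: "\<Gamma> \<turnstile> a \<Ztypecolon> App d P" and b: "\<Gamma> \<turnstile> b \<Ztypecolon> Pi P (App (lift 0 d) (lift 0 Q))"
    by (auto simp: inhab_def)
  note 1 = ty_app[OF c[unfolded SumClosed_def Let_def] P, simplified]
  note 2 = ty_app[OF 1 Q, simplified]
  note 3 = ty_app[OF 2 a, simplified]
  note 4 = ty_app[OF 3 b, simplified]
  from 4 show ?thesis by (rule inhabI)
qed

lemma ty_SumClosed: "\<Gamma> \<turnstile> SumClosed n d \<Ztypecolon> Univ (Suc n)"
proof -
  let ?\<Gamma>1 = "Univ n # \<Gamma>" let ?\<Gamma>2 = "Univ n # ?\<Gamma>1"
  interpret d1: prop_set n ?\<Gamma>1 "lift 0 d" "lift 0 s" by (rule weaken[OF ty_U])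
  interpret d2: prop_set n ?\<Gamma>2 "lift 0 (lift 0 d)" "lift 0 (lift 0 s)"
      by (rule d1.weaken[OF d1.ty_U])
  have P: "?\<Gamma>2 \<turnstile> Var (Suc 0) \<Ztypecolon> Univ n"
    using wk_ty[OF d1.ty_U var0[OF ty_U, simplified]] by simp
  have Q: "?\<Gamma>2 \<turnstile> Var 0 \<Ztypecolon> Univ n"
    using var0[OF d1.ty_U] by simp
  note dP = d2.ty_d[OF P]
  interpret d3: prop_set n "App (lift 0 (lift 0 d)) (Var (Suc 0)) # ?\<Gamma>2"
      "lift 0 (lift 0 (lift 0 d))" "lift 0 (lift 0 (lift 0 s))"
    by (rule d2.weaken[OF dP])
  note P3 = wk_ty[OF dP P] and Q3 = wk_ty[OF dP Q]
  note PdQ = ty_pi[OF P3 wk_ty[OF P3 d3.ty_d[OF Q3]]]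
  note R = wk_ty[OF PdQ d3.ty_d[OF ty_sig[OF P3 wk_ty[OF P3 Q3], simplified]]]
  from ty_pi[OF ty_U ty_pi[OF d1.ty_U ty_pi[OF dP ty_pi[OF PdQ R]]]] show ?thesis
    by (simp add: SumClosed_def Let_def max_def)
qed

lemma ty_Dominance: "\<Gamma> \<turnstile> Dominance n d \<Ztypecolon> Univ (Suc n)"
proof -
  note 1 = ty_d[OF ty_One[OF typing_ctx(2)[OF d]]]
  note 2 = ty_sig[OF 1 wk_ty[OF 1 ty_SumClosed]]
  from ty_sig[OF ty_SetOfProps[OF d] wk_ty[OF ty_SetOfProps[OF d] 2]] show ?thesis
    by (simp add: Dominance_def max_def)
qed

lemma UnitFactors:
  shows ty_UnitFactors: "\<Gamma> \<turnstile> UnitFactors n d s \<Ztypecolon> Univ (Suc n)"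
    and UnitFactors_intro: "inhab \<Gamma> (App d (One n)) \<Longrightarrow> inhab \<Gamma> (UnitFactors n d s)"
proof -
  interpret d1: prop_set n "Univ n # \<Gamma>" "lift 0 d" "lift 0 s" by (rule weaken[OF ty_U])
  note Y = var0[OF ty_U, simplified]
  show "\<Gamma> \<turnstile> UnitFactors n d s \<Ztypecolon> Univ (Suc n)"
    using ty_pi[OF ty_U d1.ty_Factor[OF Y Y ty_Eta[OF Y]]] by (simp add: UnitFactors_def max_def)
  assume "inhab \<Gamma> (App d (One n))"
  then have "inhab (Univ n # \<Gamma>) (App (lift 0 d) (One n))"
    using wk[OF ty_U] by (force simp: inhab_def)
  from inhab_lam[OF d1.Factor_Eta[OF Y this]] show "inhab \<Gamma> (UnitFactors n d s)"
    by (simp add: UnitFactors_def)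
qed

lemma UnitFactors_elim: "inhab \<Gamma> (UnitFactors n d s) \<Longrightarrow> inhab \<Gamma> (App d (One n))"
  using ty_app[OF _ ty_One[OF typing_ctx(2)[OF d]]]
  by (intro d_One) (force simp: UnitFactors_def inhab_def)

lemma KleisliFactors:
  shows ty_KleisliFactors: "\<Gamma> \<turnstile> KleisliFactors n d s \<Ztypecolon> Univ (Suc n)"
    and KleisliFactors_intro: "inhab \<Gamma> (SumClosed n d) \<Longrightarrow> inhab \<Gamma> (KleisliFactors n d s)"
proof -
  let ?\<Gamma>1 = "Univ n # \<Gamma>" let ?\<Gamma>2 = "Univ n # ?\<Gamma>1"
  let ?d2 = "lift 0 (lift 0 d)" let ?s2 = "lift 0 (lift 0 s)"
  interpret d1: prop_set n ?\<Gamma>1 "lift 0 d" "lift 0 s" by (rule weaken[OF ty_U])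
  interpret d2: prop_set n ?\<Gamma>2 ?d2 ?s2 by (rule d1.weaken[OF d1.ty_U])
  have X2: "?\<Gamma>2 \<turnstile> Var (Suc 0) \<Ztypecolon> Univ n"
    using wk_ty[OF d1.ty_U var0[OF ty_U, simplified]] by simp
  have Y2: "?\<Gamma>2 \<turnstile> Var 0 \<Ztypecolon> Univ n"
    using var0[OF d1.ty_U] by simp
  let ?T = "Pi (Var (Suc 0)) (lift 0 (LiftdTm n ?d2 (Var 0)))"
  note T = ty_pi[OF X2 wk_ty[OF X2 d2.ty_LiftdTm[OF Y2]]]
  let ?\<Gamma>3 = "?T # ?\<Gamma>2"
  interpret d3: prop_set n ?\<Gamma>3 "lift 0 ?d2" "lift 0 ?s2" by (rule d2.weaken[OF T])
  have X: "?\<Gamma>3 \<turnstile> Var (Suc (Suc 0)) \<Ztypecolon> Univ n" and Y: "?\<Gamma>3 \<turnstile> Var (Suc 0) \<Ztypecolon> Univ n"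
    using wk_ty[OF T X2] wk_ty[OF T Y2] by simp_all
  have f: "?\<Gamma>3 \<turnstile> Var 0 \<Ztypecolon> Pi (Var (Suc (Suc 0))) (lift 0 (LiftdTm n (lift 0 ?d2) (Var (Suc 0))))"
    using var0[OF T] by simp
  note L = d3.ty_LiftdTm[OF X]
  show "\<Gamma> \<turnstile> KleisliFactors n d s \<Ztypecolon> Univ (Suc n)"
    using ty_pi[OF ty_U ty_pi[OF d1.ty_U ty_pi[OF T d3.ty_Factor[OF L Y d3.ty_KleisliIncl[OF X Y
        f]]]]]
    by (simp add: KleisliFactors_def Let_def max_def)
  assume "inhab \<Gamma> (SumClosed n d)"
  then obtain c where c: "\<Gamma> \<turnstile> c \<Ztypecolon> SumClosed n d" by (auto simp: inhab_def)
  interpret d4: prop_set n "LiftdTm n (lift 0 ?d2) (Var (Suc (Suc 0))) # ?\<Gamma>3"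
      "lift 0 (lift 0 ?d2)" "lift 0 (lift 0 ?s2)"
    by (rule d3.weaken[OF L])
  have "inhab (LiftdTm n (lift 0 ?d2) (Var (Suc (Suc 0))) # ?\<Gamma>3) (SumClosed n (lift 0 (lift 0
      ?d2)))"
    \<comment> \<open>Four weakenings, for X, Y, f and the generic element at which the
      factorisation is checked.\<close>
    using inhabI[OF wk[OF L wk[OF T wk[OF d1.ty_U wk[OF ty_U c]]]]] by simp
  from d3.Factor_KleisliIncl[OF X Y f d4.SumClosed_elim[OF this]]
  show "inhab \<Gamma> (KleisliFactors n d s)"
    unfolding KleisliFactors_def Let_def by (intro inhab_lam)
qed

lemma KleisliFactors_elim:
  assumes m: "inhab \<Gamma> (KleisliFactors n d s)" and X: "\<Gamma> \<turnstile> X \<Ztypecolon> Univ n" and Y: "\<Gamma> \<turnstile> Y \<Ztypecolon> Univ n"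
    and f: "\<Gamma> \<turnstile> f \<Ztypecolon> Pi X (lift 0 (LiftdTm n d Y))"
  shows "inhab \<Gamma> (Factor n d s (LiftdTm n d X) Y (KleisliIncl n d s X Y f))"
proof -
  from m obtain m where m: "\<Gamma> \<turnstile> m \<Ztypecolon> KleisliFactors n d s" by (auto simp: inhab_def)
  note 1 = ty_app[OF m[unfolded KleisliFactors_def Let_def] X, simplified]
  note 2 = ty_app[OF 1 Y, simplified]
  note 3 = ty_app[OF 2 f[simplified], simplified]
  from 3 show ?thesis by (rule inhabI)
qed

text \<open>P, Q and the two proofs are the four context variables; \<open>d_closed\<close> applies
  there to the weakened Kleisli factorisations.\<close>

lemma SumClosed_intro:
  assumes m: "inhab \<Gamma> (KleisliFactors n d s)"
  shows "inhab \<Gamma> (SumClosed n d)"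
proof -
  let ?\<Gamma>1 = "Univ n # \<Gamma>" let ?\<Gamma>2 = "Univ n # ?\<Gamma>1"
  let ?d2 = "lift 0 (lift 0 d)" let ?s2 = "lift 0 (lift 0 s)"
  let ?d3 = "lift 0 ?d2" let ?s3 = "lift 0 ?s2"
  interpret d1: prop_set n ?\<Gamma>1 "lift 0 d" "lift 0 s" by (rule weaken[OF ty_U])
  interpret d2: prop_set n ?\<Gamma>2 ?d2 ?s2 by (rule d1.weaken[OF d1.ty_U])
  have P2: "?\<Gamma>2 \<turnstile> Var (Suc 0) \<Ztypecolon> Univ n"
    using wk_ty[OF d1.ty_U var0[OF ty_U, simplified]] by simp
  have Q2: "?\<Gamma>2 \<turnstile> Var 0 \<Ztypecolon> Univ n"
    using var0[OF d1.ty_U] by simp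
  let ?\<Gamma>3 = "App ?d2 (Var (Suc 0)) # ?\<Gamma>2"
  note dP = d2.ty_d[OF P2]
  interpret d3: prop_set n ?\<Gamma>3 ?d3 ?s3 by (rule d2.weaken[OF dP])
  have P3: "?\<Gamma>3 \<turnstile> Var (Suc (Suc 0)) \<Ztypecolon> Univ n" and Q3: "?\<Gamma>3 \<turnstile> Var (Suc 0) \<Ztypecolon> Univ n"
    using wk_ty[OF dP P2] wk_ty[OF dP Q2] by simp_all
  let ?T = "Pi (Var (Suc (Suc 0))) (lift 0 (App ?d3 (Var (Suc 0))))"
  note T = ty_pi[OF P3 wk_ty[OF P3 d3.ty_d[OF Q3]]]
  interpret d4: prop_set n "?T # ?\<Gamma>3" "lift 0 ?d3" "lift 0 ?s3" by (rule d3.weaken[OF T])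
  have P: "?T # ?\<Gamma>3 \<turnstile> Var (Suc (Suc (Suc 0))) \<Ztypecolon> Univ n"
      and Q: "?T # ?\<Gamma>3 \<turnstile> Var (Suc (Suc 0)) \<Ztypecolon> Univ n"
    using wk_ty[OF T P3] wk_ty[OF T Q3] by simp_all
  have a: "inhab (?T # ?\<Gamma>3) (App (lift 0 ?d3) (Var (Suc (Suc (Suc 0)))))"
    using inhabI[OF wk[OF T var0[OF dP]]] by simp
  have b: "inhab (Var (Suc (Suc (Suc 0))) # ?T # ?\<Gamma>3) (lift 0 (App (lift 0 ?d3)
      (Var (Suc (Suc 0)))))"
    using inhabI[OF ty_app[OF wk[OF P var0[OF T], simplified] var0[OF P, simplified]]] by simp
  from m obtain m where m: "\<Gamma> \<turnstile> m \<Ztypecolon> KleisliFactors n d s" by (auto simp: inhab_def)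
  have "inhab (?T # ?\<Gamma>3) (KleisliFactors n (lift 0 ?d3) (lift 0 ?s3))"
    using inhabI[OF wk[OF T wk[OF dP wk[OF d1.ty_U wk[OF ty_U m]]]]] by simp
  from d4.d_closed[OF P Q a b d4.KleisliFactors_elim[OF this P Q]]
  have "inhab (?T # ?\<Gamma>3) (App (lift 0 ?d3) (Sig (Var (Suc (Suc (Suc 0))))
      (Var (Suc (Suc (Suc 0))))))"
    by simp
  then show ?thesis
    unfolding SumClosed_def Let_def by (intro inhab_lam) simp
qed

end

theorem theorem5p19:
  fixes n :: nat
  shows "inhabited
    (\<Pi> d\<in>(U n \<rightarrow> U n). \<Pi> s\<in>is_set_of_props n d. is_dominance n d \<leftrightarrow> is_submonad n d s)"
proof -
  have ty_U: "[] \<turnstile> Univ n \<Ztypecolon> Univ (Suc n)" by (intro ty_univ ctx_nil)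
  have D: "[] \<turnstile> Pi (Univ n) (Univ n) \<Ztypecolon> Univ (Suc n)"
    using ty_pi[OF ty_U wk_ty[OF ty_U ty_U]] by simp
  have S: "[Pi (Univ n) (Univ n)] \<turnstile> SetOfProps n (Var 0) \<Ztypecolon> Univ (Suc n)"
    using ty_SetOfProps[OF var0[OF D, simplified]] .
  define \<Gamma> where "\<Gamma> = [SetOfProps n (Var 0), Pi (Univ n) (Univ n)]"
  define d where "d = Var (Suc 0)"
  define s where "s = Var 0"
  have s_SetOfProps: "\<Gamma> \<turnstile> s \<Ztypecolon> SetOfProps n d"
    using var0[OF S] by (simp add: s_def d_def \<Gamma>_def)
  interpret prop_set n \<Gamma> d s
  proof
    show "\<Gamma> \<turnstile> d \<Ztypecolon> Pi (Univ n) (Univ n)"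
      using wk[OF S var0[OF D]] by (simp add: d_def \<Gamma>_def)
    show "\<Gamma> \<turnstile> Snd s \<Ztypecolon> Pi (Univ n) (Pi (App (lift 0 d) (Var 0)) (IsProp (Var (Suc 0))))"
      using ty_snd[OF s_SetOfProps[unfolded SetOfProps_def]] by simp
  qed
  let ?Sub = "Sig (UnitFactors n d s) (lift 0 (KleisliFactors n d s))"
  have Sub: "\<Gamma> \<turnstile> ?Sub \<Ztypecolon> Univ (Suc n)"
    using ty_sig[OF ty_UnitFactors wk_ty[OF ty_UnitFactors ty_KleisliFactors]] by simp
  have 1: "inhab \<Gamma> (Pi (Dominance n d) (lift 0 ?Sub))"
  proof (rule inhab_lam)
    interpret D: prop_set n "Dominance n d # \<Gamma>" "lift 0 d" "lift 0 s"
        by (rule weaken[OF ty_Dominance])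
    have "inhab (Dominance n d # \<Gamma>) (Dominance n (lift 0 d))"
      using inhabI[OF var0[OF ty_Dominance]] by simp
    then have D: "inhab (Dominance n d # \<Gamma>) (Sig (App (lift 0 d) (One n)) (lift 0 (SumClosed n
        (lift 0 d))))"
      unfolding Dominance_def[of n "lift 0 d"] by (rule inhab_snd)
    show "inhab (Dominance n d # \<Gamma>) (lift 0 ?Sub)"
      using inhab_pair[OF D.ty_KleisliFactors D.ty_UnitFactors D.UnitFactors_intro[OF inhab_fst[OF
        D]] D.KleisliFactors_intro[OF inhab_snd[OF D]]] by simp
  qed
  have 2: "inhab \<Gamma> (Pi ?Sub (lift 0 (Dominance n d)))"
  proof (rule inhab_lam)
    interpret M: prop_set n "?Sub # \<Gamma>" "lift 0 d" "lift 0 s" by (rule weaken[OF Sub])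
    have M: "inhab (?Sub # \<Gamma>) (Sig (UnitFactors n (lift 0 d) (lift 0 s)) (lift 0 (KleisliFactors n
        (lift 0 d) (lift 0 s))))"
      using inhabI[OF var0[OF Sub]] by simp
    note O = M.ty_d[OF ty_One[OF typing_ctx(2)[OF M.d]]]
    note 1 = inhab_pair[OF M.ty_SumClosed O M.UnitFactors_elim[OF inhab_fst[OF M]]
        M.SumClosed_intro[OF inhab_snd[OF M]]]
    \<comment> \<open>A dominance includes being a set of propositions; this component is the
      hypothesis \<open>s\<close>, weakened.\<close>
    have s1: "inhab (?Sub # \<Gamma>) (SetOfProps n (lift 0 d))"
      using inhabI[OF wk[OF Sub s_SetOfProps]] by simp
    have "inhab (?Sub # \<Gamma>) (Dominance n (lift 0 d))"
      unfolding Dominance_def by (rule inhab_pair[OF ty_sig[OF O wk_ty[OF O M.ty_SumClosed]]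
        ty_SetOfProps[OF M.d] s1 1])
    then show "inhab (?Sub # \<Gamma>) (lift 0 (Dominance n d))" by simp
  qed
  have "inhab \<Gamma> (Sig (Pi (Dominance n d) (lift 0 ?Sub)) (lift 0 (Pi ?Sub (lift 0 (Dominance n
      d)))))"
    by (rule inhab_pair[OF ty_pi[OF Sub wk_ty[OF Sub ty_Dominance]] ty_pi[OF ty_Dominance wk_ty[OF
        ty_Dominance Sub]] 1 2])
  then have "inhab [] (Pi (Pi (Univ n) (Univ n)) (Pi (SetOfProps n (Var 0))
      (Sig (Pi (Dominance n d) (lift 0 ?Sub)) (lift 0 (Pi ?Sub (lift 0 (Dominance n d)))))))"
    unfolding \<Gamma>_def by (intro inhab_lam)
  \<comment> \<open>An equality of terms in HOL, not a conversion in the type theory: unfolding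
    turns the named syntax into exactly the de Bruijn term used so far.\<close>
  also have "Pi (Pi (Univ n) (Univ n)) (Pi (SetOfProps n (Var 0))
      (Sig (Pi (Dominance n d) (lift 0 ?Sub)) (lift 0 (Pi ?Sub (lift 0 (Dominance n d)))))) =
    (\<Pi> d\<in>(U n \<rightarrow> U n). \<Pi> s\<in>is_set_of_props n d. is_dominance n d \<leftrightarrow> is_submonad n d s) 0"
    by (simp add: sterm_defs is_set_of_props_def is_dominance_def is_submonad_def Lift_def
        Lift_d_def
        defined_def witness_def val_def unit_prop_def sigma_prop_def \<eta>_def kleisli_def incl_def
          compose_def
        d_def s_def SetOfProps_def Dominance_def SumClosed_def UnitFactors_def KleisliFactors_def
          Factor_def KleisliIncl_def Comp_def Incl_def Eta_def UnitProp_def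
        Kleisli_def kl_defined_def kl_witness_def kl_val_def sigma_path_def LiftTm_def LiftdTm_def
          Partial_def IsProp_def Let_def)
  finally show ?thesis by (simp add: inhabited_def inhab_def)
qed

end
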